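(* Let $\alpha\in(0,2]$, $\beta\in(0,1)$, $\nu>0$, $d\ge1$, and let $u_0:\mathbb{R}^d\to\mathbb{R}$ be measurable and bounded. Suppose $\sigma:\mathbb{R}\times\mathbb{R}^d\to\mathbb{R}$ is such that there exist a non-negative function $J$ on $\mathbb{R}^d$ and finite positive constants $Lip_\sigma$, $K$ with $\sigma(0,h)=0$ and $|\sigma(x,h)-\sigma(y,h)|\le J(h)\,Lip_\sigma\,|x-y|$ for all $x,y\in\mathbb{R}$, $h\in\mathbb{R}^d$, and $\int_{\mathbb{R}^d}J(h)\,\mu(dh)\le K$. Then there exists a unique random field solution to $$\frac{\partial^\beta u}{\partial t^\beta}+\nu(-\Delta)^{\alpha/2}u=I_t^{1-\beta}\Big[\int_{\mathbb{R}^d}\sigma(u(t,x),h)\,\dot{N}(t,x,h)\Big]$$ with initial condition $u_0$.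
   Context: Noise: $\mu$ is a Lévy measure on $\mathbb{R}^d$, i.e. $\int_{\mathbb{R}^d}(1\wedge|h|^2)\mu(dh)<\infty$. $N$ is a (non-compensated) Poisson random measure on $\mathbb{R}_+\times\mathbb{R}^d\times\mathbb{R}^d$ with intensity $dt\,dx\,\mu(dh)$. Predictability is with respect to the filtration generated by $N$. For predictable $X$ with $\int_0^T\int\int \mathbb{E}|X(s,x,h)|\,ds\,dx\,\mu(dh)<\infty$, the integral $\int_0^T\int\int X\,dN$ is defined and satisfies $\mathbb{E}\int X\,dN=\int_0^T\int\int\mathbb{E}X\,ds\,dx\,\mu(dh)$. The function $\sigma$ is jointly measurable. Kernel: $G_t(x)=G(t,x)=\int_0^\infty p_{X(s)}(x)f_{E_t}(s)\,ds$, where $p_{X(s)}$ is the density with Fourier transform $\widehat{p_{X(s)}}(\xi)=e^{-s\nu|\xi|^\alpha}$ (isotropic $\alpha$-stable process on $\mathbb{R}^d$) and $f_{E_t}(s)=t\beta^{-1}s^{-1-1/\beta}g_\beta(ts^{-1/\beta})$ is the density of the inverse $\beta$-stable subordinator $E_t$, $g_\beta$ being the density of $D_1$ for the $\beta$-stable subordinator $D$ with $\mathbb{E}e^{-\lambda D_1}=e^{-\lambda^\beta}$. It is the fundamental solution of $\partial_t^\beta G_t=-\nu(-\Delta)^{\alpha/2}G_t$ (Caputo derivative). The equation is interpreted in the mild sense. A (predictable) random field $\{u(t,x)\}_{t>0,x\in\mathbb{R}^d}$ is a mild solution with initial condition $u_0$ if, for all $t,x$, a.s., $$u(t,x)=\int_{\mathbb{R}^d}G(t,x-y)u_0(y)\,dy+\int_0^t\int_{\mathbb{R}^d}\int_{\mathbb{R}^d}G(t-s,x-y)\sigma(u(s,y),h)\,N(ds\,dy\,dh).$$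 It is a random field solution if moreover $\sup_{0\le t\le T}\sup_{x\in\mathbb{R}^d}\mathbb{E}|u(t,x)|<\infty$ for all $T>0$. Uniqueness is up to modification. *)

theory Defs
  imports "HOL-Probability.Probability"
begin

(* \<real>^d is an arbitrary type of class euclidean_space, so d \<ge> 1 is automatic. *)

section \<open>Poisson random measures\<close>

(* Given the integrability condition, sigma-finiteness only says that \<mu> {0} is finite; it is implied
   by the usual convention \<mu> {0} = 0 (see levy_measureI below). *)
definition levy_measure :: "'d::euclidean_space measure \<Rightarrow> bool" where
  "levy_measure \<mu> \<longleftrightarrow> sets \<mu> = sets borel \<and> sigma_finite_measure \<mu> \<and>
     (\<integral>\<^sup>+h. ennreal (min 1 ((norm h)\<^sup>2)) \<partial>\<mu>) < \<infinity>"

definition poisson_random_measure :: "'w measure \<Rightarrow> 'e measure \<Rightarrow> ('w \<Rightarrow> 'e measure) \<Rightarrow> bool" where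
  "poisson_random_measure M E N \<longleftrightarrow>
     sigma_finite_measure E \<and>
     (\<forall>\<omega>\<in>space M. sets (N \<omega>) = sets E) \<and>
     (\<forall>A\<in>sets E. (\<lambda>\<omega>. emeasure (N \<omega>) A) \<in> borel_measurable M) \<and>
     (\<forall>A\<in>sets E. emeasure E A < \<infinity> \<longrightarrow>
        (\<forall>k::nat. measure M {\<omega>\<in>space M. emeasure (N \<omega>) A = of_nat k} =
           exp (- measure E A) * measure E A ^ k / fact k)) \<and>
     (\<forall>A\<in>sets E. emeasure E A = \<infinity> \<longrightarrow> (AE \<omega> in M. emeasure (N \<omega>) A = \<infinity>)) \<and>
     (\<forall>\<A>. finite \<A> \<and> disjoint \<A> \<and> \<A> \<subseteq> sets E \<longrightarrow>
        prob_space.indep_vars M (\<lambda>_. borel) (\<lambda>A \<omega>. emeasure (N \<omega>) A) \<A>)"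

text \<open>The intensity \<open>dt dx \<mu>(dh)\<close> on \<open>[0,\<infinity>) \<times> \<real>\<^sup>d \<times> \<real>\<^sup>d\<close>.\<close>

definition noise_intensity :: "'d::euclidean_space measure \<Rightarrow> (real \<times> 'd \<times> 'd) measure" where
  "noise_intensity \<mu> = restrict_space lborel {0..} \<Otimes>\<^sub>M (lborel \<Otimes>\<^sub>M \<mu>)"

section \<open>Predictability and stochastic integration\<close>

(* The raw filtration generated by N; it is not augmented by null sets. *)
definition noise_filtration ::
  "'w measure \<Rightarrow> 'd::euclidean_space measure \<Rightarrow> ('w \<Rightarrow> (real \<times> 'd \<times> 'd) measure) \<Rightarrow> real \<Rightarrow> 'w measure"
where
  "noise_filtration M \<mu> N t = sigma (space M)
     {(\<lambda>\<omega>. emeasure (N \<omega>) A) -` B \<inter> space M | A B.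
        A \<in> sets (noise_intensity \<mu>) \<and> A \<subseteq> {0..t} \<times> UNIV \<and> B \<in> sets borel}"

(* The product of the predictable sigma-algebra on (0,\<infinity>) \<times> \<Omega> with that of the parameter space S,
   with the arguments in the order (time, parameter, sample point). *)
definition predictable_sigma ::
  "'w set \<Rightarrow> (real \<Rightarrow> 'w measure) \<Rightarrow> 'e measure \<Rightarrow> (real \<times> 'e \<times> 'w) measure" where
  "predictable_sigma \<Omega> F S = sigma ({0<..} \<times> space S \<times> \<Omega>)
     {{s<..t} \<times> B \<times> A | s t B A. 0 \<le> s \<and> s < t \<and> B \<in> sets S \<and> A \<in> sets (F s)}"

definition predictable_field ::
  "'w measure \<Rightarrow> 'd::euclidean_space measure \<Rightarrow> ('w \<Rightarrow> (real \<times> 'd \<times> 'd) measure) \<Rightarrow>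
    (real \<Rightarrow> 'd \<Rightarrow> 'w \<Rightarrow> real) \<Rightarrow> bool" where
  "predictable_field M \<mu> N u \<longleftrightarrow>
     (\<lambda>(t, x, \<omega>). u t x \<omega>)
       \<in> borel_measurable (predictable_sigma (space M) (noise_filtration M \<mu> N) borel)"

definition noise_integrable ::
  "'w measure \<Rightarrow> 'd::euclidean_space measure \<Rightarrow> ('w \<Rightarrow> (real \<times> 'd \<times> 'd) measure) \<Rightarrow> real \<Rightarrow>
    (real \<Rightarrow> 'd \<Rightarrow> 'd \<Rightarrow> 'w \<Rightarrow> real) \<Rightarrow> bool" where
  "noise_integrable M \<mu> N T X \<longleftrightarrow>
     (\<lambda>(s, (y, h), \<omega>). X s y h \<omega>)
       \<in> borel_measurable (predictable_sigma (space M) (noise_filtration M \<mu> N) borel) \<and>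
     (\<integral>\<^sup>+(s, y, h)\<in>{0<..T} \<times> UNIV. (\<integral>\<^sup>+\<omega>. ennreal \<bar>X s y h \<omega>\<bar> \<partial>M) \<partial>noise_intensity \<mu>) < \<infinity>"

(* N is not compensated, so for integrands as in noise_integrable the stochastic integral is, almost
   surely, the Lebesgue integral with respect to the measure N \<omega>. *)
definition noise_integral ::
  "('w \<Rightarrow> (real \<times> 'd \<times> 'd) measure) \<Rightarrow> real \<Rightarrow> (real \<Rightarrow> 'd \<Rightarrow> 'd \<Rightarrow> 'w \<Rightarrow> real) \<Rightarrow> 'w \<Rightarrow> real" where
  "noise_integral N T X \<omega> = (LINT (s, y, h):{0<..T} \<times> UNIV|N \<omega>. X s y h \<omega>)"

section \<open>The kernel\<close>

(* p s is a version of the density, with Fourier transform exp (- s \<nu> |\<xi>|^\<alpha>), of the isotropic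
   \<alpha>-stable process at time s > 0; the versions are required to depend measurably on (s, x). *)
definition isotropic_stable_density ::
  "real \<Rightarrow> real \<Rightarrow> (real \<Rightarrow> 'd::euclidean_space \<Rightarrow> real) \<Rightarrow> bool" where
  "isotropic_stable_density \<alpha> \<nu> p \<longleftrightarrow>
     (\<lambda>(s, x). p s x) \<in> borel_measurable (restrict_space borel ({0<..} \<times> UNIV)) \<and>
     (\<forall>s>0. (\<forall>x. 0 \<le> p s x) \<and> integrable lborel (p s) \<and>
        (\<forall>\<xi>. (CLINT x|lborel. iexp (\<xi> \<bullet> x) * complex_of_real (p s x)) =
               complex_of_real (exp (- s * \<nu> * norm \<xi> powr \<alpha>))))"

(* g is a density of D_1 for the \<beta>-stable subordinator D. For l = 0 the right-hand side is 1, since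
   0 powr \<beta> = 0. *)
definition stable_subordinator_density :: "real \<Rightarrow> (real \<Rightarrow> real) \<Rightarrow> bool" where
  "stable_subordinator_density \<beta> g \<longleftrightarrow>
     g \<in> borel_measurable borel \<and> (\<forall>x. 0 \<le> g x) \<and> (\<forall>x<0. g x = 0) \<and> integrable lborel g \<and>
     (\<forall>l\<ge>0. (LINT x|lborel. exp (- l * x) * g x) = exp (- (l powr \<beta>)))"

definition inverse_subordinator_density :: "real \<Rightarrow> (real \<Rightarrow> real) \<Rightarrow> real \<Rightarrow> real \<Rightarrow> real" where
  "inverse_subordinator_density \<beta> g t s = t / \<beta> * s powr (- 1 - 1 / \<beta>) * g (t * s powr (- 1 / \<beta>))"

(* For each t > 0 the integral converges for almost every x; where it diverges (for instance at
   x = 0 if d \<ge> \<alpha>) its value is 0 by convention, which does not affect mild solutions. The kernel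
   vanishes for t = 0. *)
definition fundamental_solution ::
  "real \<Rightarrow> (real \<Rightarrow> 'd::euclidean_space \<Rightarrow> real) \<Rightarrow> (real \<Rightarrow> real) \<Rightarrow> real \<Rightarrow> 'd \<Rightarrow> real" where
  "fundamental_solution \<beta> p g t x = (LINT s:{0<..}|lborel. p s x * inverse_subordinator_density \<beta> g t s)"

section \<open>Solutions\<close>

(* G is the kernel. The existence of both integrals is part of the definition. *)
definition mild_solution ::
  "'w measure \<Rightarrow> 'd::euclidean_space measure \<Rightarrow> ('w \<Rightarrow> (real \<times> 'd \<times> 'd) measure) \<Rightarrow>
    (real \<Rightarrow> 'd \<Rightarrow> real) \<Rightarrow> (real \<Rightarrow> 'd \<Rightarrow> real) \<Rightarrow> ('d \<Rightarrow> real) \<Rightarrow> (real \<Rightarrow> 'd \<Rightarrow> 'w \<Rightarrow> real) \<Rightarrow> bool"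
where
  "mild_solution M \<mu> N G \<sigma> u\<^sub>0 u \<longleftrightarrow>
     predictable_field M \<mu> N u \<and>
     (\<forall>t>0. \<forall>x.
        integrable lborel (\<lambda>y. G t (x - y) * u\<^sub>0 y) \<and>
        noise_integrable M \<mu> N t (\<lambda>s y h \<omega>. G (t - s) (x - y) * \<sigma> (u s y \<omega>) h) \<and>
        (AE \<omega> in M. u t x \<omega> =
           (LINT y|lborel. G t (x - y) * u\<^sub>0 y) +
           noise_integral N t (\<lambda>s y h \<omega>. G (t - s) (x - y) * \<sigma> (u s y \<omega>) h) \<omega>))"

(* A solution is a field indexed by t > 0; in the supremum over 0 \<le> t \<le> T its value at t = 0 is
   taken to be the initial condition. *)
definition random_field_solution ::
  "'w measure \<Rightarrow> 'd::euclidean_space measure \<Rightarrow> ('w \<Rightarrow> (real \<times> 'd \<times> 'd) measure) \<Rightarrow>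
    (real \<Rightarrow> 'd \<Rightarrow> real) \<Rightarrow> (real \<Rightarrow> 'd \<Rightarrow> real) \<Rightarrow> ('d \<Rightarrow> real) \<Rightarrow> (real \<Rightarrow> 'd \<Rightarrow> 'w \<Rightarrow> real) \<Rightarrow> bool"
where
  "random_field_solution M \<mu> N G \<sigma> u\<^sub>0 u \<longleftrightarrow>
     mild_solution M \<mu> N G \<sigma> u\<^sub>0 u \<and>
     (\<forall>T>0. (SUP t\<in>{0..T}. SUP x. \<integral>\<^sup>+\<omega>. ennreal \<bar>if t = 0 then u\<^sub>0 x else u t x \<omega>\<bar> \<partial>M) < \<infinity>)"

definition modification ::
  "'w measure \<Rightarrow> (real \<Rightarrow> 'd \<Rightarrow> 'w \<Rightarrow> real) \<Rightarrow> (real \<Rightarrow> 'd \<Rightarrow> 'w \<Rightarrow> real) \<Rightarrow> bool" where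
  "modification M u v \<longleftrightarrow> (\<forall>t>0. \<forall>x. AE \<omega> in M. u t x \<omega> = v t x \<omega>)"

section \<open>Sanity checks\<close>

lemma levy_measureI:
  fixes \<mu> :: "'d::euclidean_space measure"
  assumes sets: "sets \<mu> = sets borel" and zero: "emeasure \<mu> {0} = 0"
    and fin: "(\<integral>\<^sup>+h. ennreal (min 1 ((norm h)\<^sup>2)) \<partial>\<mu>) < \<infinity>"
  shows "levy_measure \<mu>"
proof -
  note [measurable_cong] = sets
  have sp: "space \<mu> = UNIV"
    using sets_eq_imp_space_eq[OF sets] by simp
  let ?f = "\<lambda>h::'d. ennreal (min 1 ((norm h)\<^sup>2))"
  let ?A = "\<lambda>n::nat. {h::'d. 1 \<le> of_nat (Suc n) * ?f h}"
  have A: "?A n \<in> sets \<mu>" for n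
  proof -
    have "{h\<in>space \<mu>. 1 \<le> of_nat (Suc n) * ?f h} \<in> sets \<mu>" by measurable
    then show ?thesis by (simp add: sp)
  qed
  have A_fin: "emeasure \<mu> (?A n) \<noteq> \<infinity>" for n
  proof -
    have "emeasure \<mu> (?A n) = emeasure \<mu> {h\<in>UNIV. 1 \<le> of_nat (Suc n) * ?f h}" by simp
    also have "\<dots> \<le> of_nat (Suc n) * (\<integral>\<^sup>+h. ?f h * indicator UNIV h \<partial>\<mu>)"
      using nn_integral_Markov_inequality[of ?f UNIV \<mu> "of_nat (Suc n)"] sp sets.top[of \<mu>]
      by (simp add: sp)
    also have "\<dots> < \<infinity>"
      using fin by (simp add: ennreal_mult_less_top of_nat_less_top del: of_nat_Suc)
    finally show ?thesis by simp
  qed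
  have cover: "h = 0 \<or> (\<exists>n. h \<in> ?A n)" for h :: 'd
  proof (cases "h = 0")
    case False
    then have pos: "0 < min 1 ((norm h)\<^sup>2)" by simp
    then obtain n where n: "inverse (real (Suc n)) < min 1 ((norm h)\<^sup>2)"
      using reals_Archimedean by blast
    have "real (Suc n) * inverse (real (Suc n)) \<le> real (Suc n) * min 1 ((norm h)\<^sup>2)"
      using n by (intro mult_left_mono less_imp_le) simp_all
    then have "1 \<le> real (Suc n) * min 1 ((norm h)\<^sup>2)"
      by (simp del: of_nat_Suc min_less_iff_conj)
    then have "1 \<le> ennreal (real (Suc n) * min 1 ((norm h)\<^sup>2))"
      by (simp del: of_nat_Suc)
    also have "\<dots> = of_nat (Suc n) * ?f h"
      using pos by (simp add: ennreal_mult ennreal_of_nat_eq_real_of_nat del: of_nat_Suc)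
    finally show ?thesis by blast
  qed simp
  have "sigma_finite_measure \<mu>"
  proof
    show "\<exists>B. countable B \<and> B \<subseteq> sets \<mu> \<and> \<Union> B = space \<mu> \<and> (\<forall>a\<in>B. emeasure \<mu> a \<noteq> \<infinity>)"
    proof (intro exI[of _ "insert {0} (range ?A)"] conjI ballI)
      show "\<Union> (insert {0} (range ?A)) = space \<mu>"
        using cover unfolding sp by blast
      show "emeasure \<mu> a \<noteq> \<infinity>" if "a \<in> insert {0} (range ?A)" for a
        using that A_fin zero by (elim insertE rangeE) (simp, metis)
      have "{0} \<in> sets \<mu>"
        unfolding sets by simp
      then show "insert {0} (range ?A) \<subseteq> sets \<mu>"
        using A by blast
      show "countable (insert {0} (range ?A))"
        by (intro countable_insert countable_image countableI_type)
    qed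
  qed
  with sets fin show ?thesis by (simp add: levy_measure_def)
qed

lemma filtration_noise_filtration:
  fixes N :: "'a \<Rightarrow> (real \<times> 'b::euclidean_space \<times> 'b) measure"
  shows "filtration (space M) (noise_filtration M \<mu> N)"
proof
  show "space (noise_filtration M \<mu> N t) = space M" for t
    by (auto simp: noise_filtration_def intro!: space_measure_of)
  show "sets (noise_filtration M \<mu> N s) \<subseteq> sets (noise_filtration M \<mu> N t)" if "s \<le> t" for s t
  proof -
    define \<G> where "\<G> r = {(\<lambda>\<omega>. emeasure (N \<omega>) A) -` B \<inter> space M | A B.
        A \<in> sets (noise_intensity \<mu>) \<and> A \<subseteq> {0..r} \<times> UNIV \<and> B \<in> sets borel}" for r :: real
    have Pow: "\<G> r \<subseteq> Pow (space M)" for r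
      unfolding \<G>_def by blast
    have "A \<subseteq> {0..t} \<times> UNIV" if "A \<subseteq> {0..s} \<times> UNIV" for A :: "(real \<times> 'b \<times> 'b) set"
      using that \<open>s \<le> t\<close> by force
    then have "\<G> s \<subseteq> \<G> t"
      unfolding \<G>_def by (intro Collect_mono) metis
    then have "sigma_sets (space M) (\<G> s) \<subseteq> sigma_sets (space M) (\<G> t)"
      by (rule sigma_sets_mono')
    then show ?thesis
      unfolding noise_filtration_def \<G>_def[symmetric] by (simp add: sets_measure_of Pow)
  qed
qed

end

theory Submission
  imports Defs "HOL-Real_Asymp.Real_Asymp"
begin

text \<open>
Picard iteration in an exponentially weighted norm. For a non-negative predictable field \<open>X\<close>
the noise satisfies \<open>E \<integral> X dN = \<integral> E X ds dx \<mu>(dh)\<close>: on the generating rectangles this is the independence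
of \<open>N\<close> on the past and on the future, and it extends by uniqueness of measures. Of the kernel one only needs
that \<open>G\<close> is non-negative and jointly measurable with \<open>\<integral> G t x dx \<le> 1\<close>. Hence, if
\<open>E \<bar>u s y - v s y\<bar> \<le> c exp (l s)\<close> for all \<open>s\<close> and \<open>y\<close>, then the images of \<open>u\<close> and \<open>v\<close> under the mild map
differ in mean by at most \<open>K Lip c \<integral>\<^sub>0\<^sup>t exp (l s) ds \<le> K Lip / l \<sqdot> c exp (l t)\<close>,
which for \<open>l = 2 K Lip\<close> halves the constant.
Iterating this gives uniqueness, and almost sure and \<open>L\<^sup>1\<close> convergence of the Picard iterates.
\<close>

section \<open>Poisson random measures\<close>

text \<open>The stochastic integral is pathwise, a Lebesgue integral against
  \<open>N \<omega>\<close>, whereas a solution must be a predictable field for a filtration that is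
  not completed. The image of a field under the mild map therefore cannot be repaired on null sets
  afterwards: a version that is predictable at every sample point has to be built, although the
  kernel depends on the evaluation point (t, x) as well as on the integration point. Most of the
  work goes into this, and it is done by treating the noise as a random kernel depending predictably
  on t. Two details shape the construction. Integrals over (0, t] are replaced by integrals over (0,
  t), since the noise on (0, t) is left-continuous in t; the two agree because the kernel vanishes
  at time 0. And independence is given for finite disjoint families of sets only, so independence of
  past and future needs a refinement into atoms. First absolute moments suffice because the noise is
  not compensated: |int X dN| <= int |X| dN, whose mean is an integral against the
  intensity.\<close>

text \<open>Both the sigma-algebra \<open>G\<close> and the region \<open>S\<close> are left free so
  that the induction serves twice: for all events, and for the past \<open>F t\<close>, which only
  measures counts of sets inside \<open>{0..t} \<times> UNIV\<close>.\<close>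

lemma random_measure_nn_integral_measurable:
  assumes sets: "\<And>\<omega>. \<omega> \<in> space G \<Longrightarrow> sets (N \<omega>) = sets E" and S: "S \<in> sets E"
    and meas: "\<And>A. A \<in> sets E \<Longrightarrow> A \<subseteq> S \<Longrightarrow> (\<lambda>\<omega>. emeasure (N \<omega>) A) \<in> borel_measurable G"
    and f: "f \<in> borel_measurable E"
  shows "(\<lambda>\<omega>. \<integral>\<^sup>+z. f z * indicator S z \<partial>N \<omega>) \<in> borel_measurable G"
  using f
proof (induction rule: borel_measurable_induct)
  case (cong f g)
  then have "f z * indicator S z = g z * indicator S z" for z
    using sets.sets_into_space[OF S] by (auto simp: indicator_def)
  with cong show ?case by simp
next
  case (set A)
  have "(\<integral>\<^sup>+z. indicator A z * indicator S z \<partial>N \<omega>) = emeasure (N \<omega>) (A \<inter> S)" if "\<omega> \<in> space G" for \<omega>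
    using set S sets[OF that] by (simp flip: indicator_inter_arith)
  then show ?case
    using meas[of "A \<inter> S"] set S by (simp cong: measurable_cong)
next
  case (mult u c)
  have "(\<integral>\<^sup>+z. c * u z * indicator S z \<partial>N \<omega>) = c * (\<integral>\<^sup>+z. u z * indicator S z \<partial>N \<omega>)" if "\<omega> \<in> space G" for \<omega>
  proof -
    note [measurable_cong] = sets[OF that]
    show ?thesis using mult S by (simp add: nn_integral_cmult mult.assoc)
  qed
  with mult show ?case by (simp cong: measurable_cong)
next
  case (add u v)
  have "(\<integral>\<^sup>+z. (v z + u z) * indicator S z \<partial>N \<omega>) = (\<integral>\<^sup>+z. v z * indicator S z \<partial>N \<omega>) + (\<integral>\<^sup>+z. u z *
    indicator S z \<partial>N \<omega>)" if "\<omega> \<in> space G" for \<omega>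
  proof -
    note [measurable_cong] = sets[OF that]
    show ?thesis using add S by (simp add: nn_integral_add distrib_right)
  qed
  with add show ?case by (simp cong: measurable_cong)
next
  case (seq U)
  have "(\<integral>\<^sup>+z. Sup (range U) z * indicator S z \<partial>N \<omega>) = (SUP i. \<integral>\<^sup>+z. U i z * indicator S z \<partial>N \<omega>)" if "\<omega> \<in> space G"
    for \<omega>
  proof -
    note [measurable_cong] = sets[OF that]
    have "(\<integral>\<^sup>+z. Sup (range U) z * indicator S z \<partial>N \<omega>) = (\<integral>\<^sup>+z. (SUP i. U i z * indicator S z) \<partial>N \<omega>)"
      by (simp add: SUP_mult_right_ennreal image_comp)
    also have "\<dots> = (SUP i. \<integral>\<^sup>+z. U i z * indicator S z \<partial>N \<omega>)"
      using seq(1) S \<open>incseq U\<close>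
      by (intro nn_integral_monotone_convergence_SUP) (auto simp: incseq_def le_fun_def intro: mult_right_mono)
    finally show ?thesis .
  qed
  with seq show ?case by (simp cong: measurable_cong)
qed

text \<open>The identity passes from sets to functions by linearity and monotone convergence. With
  \<open>w = 1\<close> and \<open>c = 1\<close> it gives Campbell's formula; with \<open>w\<close>
  the indicator of an event in the past, \<open>c\<close> its probability and \<open>S\<close> a
  region in the future, it expresses their independence.\<close>

lemma random_measure_nn_integral_mean:
  assumes sets: "\<And>\<omega>. \<omega> \<in> space M \<Longrightarrow> sets (N \<omega>) = sets E" and S: "S \<in> sets E"
    and meas: "\<And>A. A \<in> sets E \<Longrightarrow> A \<subseteq> S \<Longrightarrow> (\<lambda>\<omega>. emeasure (N \<omega>) A) \<in> borel_measurable M"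
    and w[measurable]: "w \<in> borel_measurable M"
    and mean: "\<And>A. A \<in> sets E \<Longrightarrow> A \<subseteq> S \<Longrightarrow> (\<integral>\<^sup>+\<omega>. w \<omega> * emeasure (N \<omega>) A \<partial>M) = c * emeasure E A"
    and f: "f \<in> borel_measurable E"
  shows "(\<integral>\<^sup>+\<omega>. w \<omega> * (\<integral>\<^sup>+z. f z * indicator S z \<partial>N \<omega>) \<partial>M) = c * (\<integral>\<^sup>+z. f z * indicator S z \<partial>E)"
  using f
proof (induction rule: borel_measurable_induct)
  case (cong f g)
  then have "f z * indicator S z = g z * indicator S z" for z
    using sets.sets_into_space[OF S] by (auto simp: indicator_def)
  with cong show ?case by simp
next
  case (set A)
  have "(\<integral>\<^sup>+z. indicator A z * indicator S z \<partial>N \<omega>) = emeasure (N \<omega>) (A \<inter> S)" if "\<omega> \<in> space M" for \<omega>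
    using set S sets[OF that] by (simp flip: indicator_inter_arith)
  moreover have "(\<integral>\<^sup>+z. indicator A z * indicator S z \<partial>E) = emeasure E (A \<inter> S)"
    using set S by (simp flip: indicator_inter_arith)
  ultimately show ?case
    using mean[of "A \<inter> S"] set S by (simp cong: nn_integral_cong)
next
  case (mult u k)
  note [measurable] = random_measure_nn_integral_measurable[OF sets S meas mult(2)]
  have "(\<integral>\<^sup>+z. k * u z * indicator S z \<partial>N \<omega>) = k * (\<integral>\<^sup>+z. u z * indicator S z \<partial>N \<omega>)" if "\<omega> \<in> space M" for \<omega>
  proof -
    note [measurable_cong] = sets[OF that]
    show ?thesis using mult S by (simp add: nn_integral_cmult mult.assoc)
  qed
  then have "(\<integral>\<^sup>+\<omega>. w \<omega> * (\<integral>\<^sup>+z. k * u z * indicator S z \<partial>N \<omega>) \<partial>M)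
     = (\<integral>\<^sup>+\<omega>. k * (w \<omega> * (\<integral>\<^sup>+z. u z * indicator S z \<partial>N \<omega>)) \<partial>M)"
    by (intro nn_integral_cong) (simp add: ac_simps)
  also have "\<dots> = k * (\<integral>\<^sup>+\<omega>. w \<omega> * (\<integral>\<^sup>+z. u z * indicator S z \<partial>N \<omega>) \<partial>M)"
    by (intro nn_integral_cmult) measurable
  also have "\<dots> = c * (\<integral>\<^sup>+z. k * u z * indicator S z \<partial>E)"
    using mult S by (simp add: nn_integral_cmult mult.assoc) (simp add: ac_simps)
  finally show ?case .
next
  case (add u v)
  have int_measurable: "(\<lambda>\<omega>. \<integral>\<^sup>+z. f z * indicator S z \<partial>N \<omega>) \<in> borel_measurable M"
    if "f \<in> borel_measurable E" for f
    by (rule random_measure_nn_integral_measurable[OF sets S meas that])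
  have "(\<integral>\<^sup>+z. (v z + u z) * indicator S z \<partial>N \<omega>) = (\<integral>\<^sup>+z. v z * indicator S z \<partial>N \<omega>) + (\<integral>\<^sup>+z. u z *
    indicator S z \<partial>N \<omega>)" if "\<omega> \<in> space M" for \<omega>
  proof -
    note [measurable_cong] = sets[OF that]
    show ?thesis using add S by (simp add: nn_integral_add distrib_right)
  qed
  then have "(\<integral>\<^sup>+\<omega>. w \<omega> * (\<integral>\<^sup>+z. (v z + u z) * indicator S z \<partial>N \<omega>) \<partial>M)
     = (\<integral>\<^sup>+\<omega>. w \<omega> * (\<integral>\<^sup>+z. v z * indicator S z \<partial>N \<omega>) + w \<omega> * (\<integral>\<^sup>+z. u z * indicator S z \<partial>N \<omega>) \<partial>M)"
    by (intro nn_integral_cong) (simp add: distrib_left)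
  also have "\<dots> = c * (\<integral>\<^sup>+z. v z * indicator S z \<partial>E) + c * (\<integral>\<^sup>+z. u z * indicator S z \<partial>E)"
    using add(6,7) int_measurable[OF \<open>u \<in> borel_measurable E\<close>] int_measurable[OF \<open>v \<in> borel_measurable E\<close>]
    by (subst nn_integral_add) simp_all
  also have "\<dots> = c * (\<integral>\<^sup>+z. (v z + u z) * indicator S z \<partial>E)"
    using add S by (simp add: nn_integral_add distrib_right distrib_left)
  finally show ?case .
next
  case (seq U)
  have [measurable]: "(\<lambda>\<omega>. \<integral>\<^sup>+z. U i z * indicator S z \<partial>N \<omega>) \<in> borel_measurable M" for i
    by (rule random_measure_nn_integral_measurable[OF sets S meas seq(1)])
  have lim: "(\<integral>\<^sup>+z. Sup (range U) z * indicator S z \<partial>R) = (SUP i. \<integral>\<^sup>+z. U i z * indicator S z \<partial>R)" if "sets R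
    = sets E" for R
  proof -
    note [measurable_cong] = that
    have "(\<integral>\<^sup>+z. Sup (range U) z * indicator S z \<partial>R) = (\<integral>\<^sup>+z. (SUP i. U i z * indicator S z) \<partial>R)"
      by (simp add: SUP_mult_right_ennreal image_comp)
    also have "\<dots> = (SUP i. \<integral>\<^sup>+z. U i z * indicator S z \<partial>R)"
      using seq(1) S \<open>incseq U\<close>
      by (intro nn_integral_monotone_convergence_SUP) (auto simp: incseq_def le_fun_def intro: mult_right_mono)
    finally show ?thesis .
  qed
  have inc: "incseq (\<lambda>i. w \<omega> * (\<integral>\<^sup>+z. U i z * indicator S z \<partial>N \<omega>))" for \<omega>
    using \<open>incseq U\<close>
    by (auto simp: incseq_def le_fun_def intro!: mult_left_mono nn_integral_mono mult_right_mono)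
  have "(\<integral>\<^sup>+\<omega>. w \<omega> * (\<integral>\<^sup>+z. Sup (range U) z * indicator S z \<partial>N \<omega>) \<partial>M)
     = (\<integral>\<^sup>+\<omega>. (SUP i. w \<omega> * (\<integral>\<^sup>+z. U i z * indicator S z \<partial>N \<omega>)) \<partial>M)"
    using lim[OF sets] by (intro nn_integral_cong) (simp add: SUP_mult_left_ennreal)
  also have "\<dots> = (SUP i. \<integral>\<^sup>+\<omega>. w \<omega> * (\<integral>\<^sup>+z. U i z * indicator S z \<partial>N \<omega>) \<partial>M)"
    using inc by (intro nn_integral_monotone_convergence_SUP) (auto simp: incseq_def le_fun_def)
  also have "\<dots> = c * (\<integral>\<^sup>+z. Sup (range U) z * indicator S z \<partial>E)"
    using seq lim[OF refl] by (simp add: SUP_mult_left_ennreal)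
  finally show ?case .
qed

section \<open>Mean counts, and independence of the noise on disjoint regions\<close>

text \<open>Points of \<open>S\<close> are grouped by the members of \<open>\<F>\<close> that
  contain them. A group is determined by a subset of \<open>\<F>\<close>, so there are finitely
  many, and every member of \<open>\<F>\<close> is the union of the groups inside it. Only groups of
  actual points are kept, hence none is empty.\<close>

lemma disjoint_refinement:
  assumes "finite \<F>" "\<F> \<subseteq> sets E" "\<And>A. A \<in> \<F> \<Longrightarrow> A \<subseteq> S" "S \<in> sets E"
  obtains \<A> where "finite \<A>" "disjoint \<A>" "\<A> \<subseteq> sets E" "\<And>c. c \<in> \<A> \<Longrightarrow> c \<subseteq> S \<and> c \<noteq> {}"
    "\<And>A. A \<in> \<F> \<Longrightarrow> A = \<Union>{c\<in>\<A>. c \<subseteq> A}"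
proof
  define atom where "atom x = {y\<in>S. \<forall>A\<in>\<F>. y \<in> A \<longleftrightarrow> x \<in> A}" for x
  have eq: "atom x = S \<inter> (\<Inter>A\<in>{A\<in>\<F>. x \<in> A}. A \<inter> S) - \<Union>{A\<in>\<F>. x \<notin> A}" for x
    unfolding atom_def using assms(3) by blast
  define \<A> where "\<A> = atom ` S"
  have "\<A> \<subseteq> (\<lambda>\<G>. {y\<in>S. \<forall>A\<in>\<F>. y \<in> A \<longleftrightarrow> A \<in> \<G>}) ` Pow \<F>"
  proof
    fix c assume "c \<in> \<A>"
    then obtain x where "c = atom x" by (auto simp: \<A>_def)
    then show "c \<in> (\<lambda>\<G>. {y\<in>S. \<forall>A\<in>\<F>. y \<in> A \<longleftrightarrow> A \<in> \<G>}) ` Pow \<F>"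
      by (intro image_eqI[of _ _ "{A\<in>\<F>. x \<in> A}"]) (auto simp: atom_def)
  qed
  then show "finite \<A>"
    by (rule finite_subset) (use assms in simp)
  show "disjoint \<A>"
    unfolding \<A>_def disjoint_def atom_def by blast
  have "atom x \<in> sets E" for x
  proof -
    have "S \<inter> (\<Inter>A\<in>{A\<in>\<F>. x \<in> A}. A \<inter> S) \<in> sets E"
    proof (cases "{A\<in>\<F>. x \<in> A} = {}")
      case False
      then show ?thesis using assms by (intro sets.Int sets.finite_INT) auto
    next
      case True
      then have "(\<Inter>A\<in>{A\<in>\<F>. x \<in> A}. A \<inter> S) = UNIV" by blast
      then show ?thesis using assms by simp
    qed
    moreover have "\<Union>{A\<in>\<F>. x \<notin> A} \<in> sets E"
      using assms by (intro sets.finite_Union) auto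
    ultimately show ?thesis unfolding eq by blast
  qed
  then show "\<A> \<subseteq> sets E" by (auto simp: \<A>_def)
  show "c \<subseteq> S \<and> c \<noteq> {}" if "c \<in> \<A>" for c
    using that by (auto simp: \<A>_def atom_def)
  show "A = \<Union>{c\<in>\<A>. c \<subseteq> A}" if "A \<in> \<F>" for A
  proof (intro equalityI subsetI)
    fix x assume "x \<in> A"
    then have "atom x \<in> \<A>" "atom x \<subseteq> A" "x \<in> atom x"
      using that assms(3)[OF that] by (auto simp: \<A>_def atom_def)
    then show "x \<in> \<Union>{c\<in>\<A>. c \<subseteq> A}" by blast
  qed auto
qed

locale poisson_rm = prob_space M for M :: "'w measure" +
  fixes E :: "'e measure" and N :: "'w \<Rightarrow> 'e measure"
  assumes prm: "poisson_random_measure M E N"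
begin

lemma sets_N: "\<omega> \<in> space M \<Longrightarrow> sets (N \<omega>) = sets E"
  using prm by (simp add: poisson_random_measure_def)

lemma emeasure_N_measurable[measurable]:
  "A \<in> sets E \<Longrightarrow> (\<lambda>\<omega>. emeasure (N \<omega>) A) \<in> borel_measurable M"
  using prm by (simp add: poisson_random_measure_def)

text \<open>The definition prescribes the probabilities of the natural values only. As these sum to
  1, the count is almost surely a natural number, and its mean is the sum of \<open>k\<close> times
  the probability of \<open>k\<close>.\<close>

lemma mean_N:
  assumes A[measurable]: "A \<in> sets E"
  shows "(\<integral>\<^sup>+\<omega>. emeasure (N \<omega>) A \<partial>M) = emeasure E A"
proof (cases "emeasure E A < \<infinity>")
  case False
  then have inf: "emeasure E A = \<infinity>" by (simp add: less_top[symmetric])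
  then have "AE \<omega> in M. emeasure (N \<omega>) A = \<infinity>"
    using prm A by (simp add: poisson_random_measure_def)
  then have "(\<integral>\<^sup>+\<omega>. emeasure (N \<omega>) A \<partial>M) = (\<integral>\<^sup>+\<omega>. \<infinity> \<partial>M)"
    by (rule nn_integral_cong_AE)
  then show ?thesis using inf by (simp add: emeasure_space_1)
next
  case True
  define m where "m = measure E A"
  have m: "emeasure E A = ennreal m" "0 \<le> m"
    using True by (simp_all add: m_def emeasure_eq_ennreal_measure)
  let ?B = "\<lambda>k::nat. {\<omega>\<in>space M. emeasure (N \<omega>) A = of_nat k}"
  have P: "prob (?B k) = exp (- m) * m ^ k / fact k" for k
    using prm A True by (simp add: poisson_random_measure_def m_def)
  have disj: "disjoint_family ?B"
    by (auto simp: disjoint_family_on_def)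
  have e: "(\<lambda>k. m ^ k / fact k) sums exp m"
    using exp_converges[of m] by (simp add: divide_inverse mult.commute)
  have "(\<lambda>k. prob (?B k)) sums (exp (- m) * exp m)"
    unfolding P using sums_mult[OF e, of "exp (- m)"] by simp
  moreover have "(\<lambda>k. prob (?B k)) sums prob (\<Union>k. ?B k)"
    by (intro finite_measure_UNION disj) auto
  ultimately have "prob (\<Union>k. ?B k) = 1"
    by (simp add: sums_iff exp_minus_inverse mult.commute)
  then have "AE \<omega> in M. \<omega> \<in> (\<Union>k. ?B k)"
    by (subst (asm) prob_eq_1) auto
  then have "AE \<omega> in M. emeasure (N \<omega>) A = (\<Sum>k. of_nat k * indicator (?B k) \<omega>)"
  proof eventually_elim
    case (elim \<omega>)
    then obtain k where k: "\<omega> \<in> ?B k" by blast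
    have "(\<Sum>k. of_nat k * indicator (?B k) \<omega> :: ennreal) = (\<Sum>k\<in>{k}. of_nat k * indicator (?B k) \<omega>)"
      using k by (intro suminf_finite) (auto simp: indicator_def)
    also have "\<dots> = of_nat k"
      using k by (subst sum.insert) (auto simp del: mem_Collect_eq)
    finally show ?case using k by auto
  qed
  then have "(\<integral>\<^sup>+\<omega>. emeasure (N \<omega>) A \<partial>M) = (\<integral>\<^sup>+\<omega>. (\<Sum>k. of_nat k * indicator (?B k) \<omega>) \<partial>M)"
    by (rule nn_integral_cong_AE)
  also have "\<dots> = (\<Sum>k. \<integral>\<^sup>+\<omega>. of_nat k * indicator (?B k) \<omega> \<partial>M)"
    by (intro nn_integral_suminf) auto
  also have "\<dots> = (\<Sum>k. of_nat k * emeasure M (?B k))"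
    by (intro suminf_cong nn_integral_cmult_indicator) auto
  also have "\<dots> = (\<Sum>k. ennreal (real k * (exp (- m) * m ^ k / fact k)))"
  proof (rule suminf_cong)
    show "of_nat k * emeasure M (?B k) = ennreal (real k * (exp (- m) * m ^ k / fact k))" for k
      unfolding emeasure_eq_measure P using m(2)
      by (simp only: ennreal_of_nat_eq_real_of_nat) (subst ennreal_mult, simp_all)
  qed
  also have "\<dots> = ennreal m"
  proof (rule suminf_ennreal_eq)
    \<comment> \<open>Index shift: the term for k = 0 vanishes, and k / k! = 1 / (k - 1)!
      otherwise.\<close>
    have "(\<lambda>k. (exp (- m) * m) * (m ^ k / fact k)) sums ((exp (- m) * m) * exp m)"
      by (rule sums_mult[OF e])
    then have "(\<lambda>k. real (Suc k) * (exp (- m) * m ^ (Suc k) / fact (Suc k))) sums m"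
      by (simp add: field_simps exp_minus_inverse del: of_nat_Suc flip: exp_add)
    then show "(\<lambda>k. real k * (exp (- m) * m ^ k / fact k)) sums m"
      by (subst (asm) sums_Suc_iff) simp
  qed (use m in simp)
  finally show ?thesis by (simp add: m)
qed

lemma nn_integral_N_measurable:
  assumes f: "f \<in> borel_measurable E"
  shows "(\<lambda>\<omega>. \<integral>\<^sup>+z. f z \<partial>N \<omega>) \<in> borel_measurable M"
proof -
  have "(\<lambda>\<omega>. \<integral>\<^sup>+z. f z * indicator (space E) z \<partial>N \<omega>) \<in> borel_measurable M"
    by (rule random_measure_nn_integral_measurable[OF sets_N _ _ f]) auto
  also have "?this \<longleftrightarrow> ?thesis"
    using sets_eq_imp_space_eq[OF sets_N] by (intro measurable_cong nn_integral_cong) auto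
  finally show ?thesis .
qed

text \<open>Campbell's formula for deterministic integrands, used later to see that the reweighted
  noise has finite mass.\<close>

lemma nn_integral_mean_N:
  assumes f: "f \<in> borel_measurable E"
  shows "(\<integral>\<^sup>+\<omega>. (\<integral>\<^sup>+z. f z \<partial>N \<omega>) \<partial>M) = (\<integral>\<^sup>+z. f z \<partial>E)"
proof -
  have "(\<integral>\<^sup>+\<omega>. 1 * (\<integral>\<^sup>+z. f z * indicator (space E) z \<partial>N \<omega>) \<partial>M) = 1 * (\<integral>\<^sup>+z. f z * indicator (space E) z \<partial>E)"
    by (rule random_measure_nn_integral_mean[OF sets_N _ _ _ _ f]) (auto simp: mean_N)
  moreover have "(\<integral>\<^sup>+\<omega>. (\<integral>\<^sup>+z. f z * indicator (space E) z \<partial>N \<omega>) \<partial>M) = (\<integral>\<^sup>+\<omega>. (\<integral>\<^sup>+z. f z \<partial>N \<omega>) \<partial>M)"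
    using sets_eq_imp_space_eq[OF sets_N] by (intro nn_integral_cong) auto
  moreover have "(\<integral>\<^sup>+z. f z * indicator (space E) z \<partial>E) = (\<integral>\<^sup>+z. f z \<partial>E)"
    by (intro nn_integral_cong) auto
  ultimately show ?thesis by simp
qed

text \<open>Generators of the information carried by the noise on \<open>S\<close>; for
  \<open>S = {0..t} \<times> UNIV\<close> these are the generators of
  \<open>noise_filtration M \<mu> N t\<close>.\<close>

definition history :: "'e set \<Rightarrow> 'w set set" where
  "history S = {(\<lambda>\<omega>. emeasure (N \<omega>) A) -` T \<inter> space M | A T. A \<in> sets E \<and> A \<subseteq> S \<and> T \<in> sets borel}"

text \<open>The generators in \<open>history S\<close> involve a single set each and are not closed
  under intersection, so finite cylinders \<open>\<P>\<close> serve as the pi-system. For one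
  cylinder, its sets are refined into disjoint atoms inside \<open>S\<close>; together with
  \<open>B\<close> these form a disjoint family, to which the independence in the definition
  applies.\<close>

lemma indep_history:
  assumes S: "S \<in> sets E" and B: "B \<in> sets E" and SB: "S \<inter> B = {}"
    and A: "A \<in> sigma_sets (space M) (history S)" and T: "T \<in> sets borel"
  shows "prob (A \<inter> ((\<lambda>\<omega>. emeasure (N \<omega>) B) -` T \<inter> space M))
    = prob A * prob ((\<lambda>\<omega>. emeasure (N \<omega>) B) -` T \<inter> space M)"
proof -
  let ?cyl = "\<lambda>\<F> b. {\<omega>\<in>space M. \<forall>A\<in>\<F>. emeasure (N \<omega>) A \<in> b A}"
  define \<P> where "\<P> = {?cyl \<F> b | \<F> b. finite \<F> \<and> \<F> \<subseteq> sets E \<and> (\<forall>A\<in>\<F>. A \<subseteq> S) \<and> (\<forall>A\<in>\<F>. b A \<in> sets borel)}"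
  define \<Q> where "\<Q> = {(\<lambda>\<omega>. emeasure (N \<omega>) B) -` T \<inter> space M | T. T \<in> sets borel}"
  have "Int_stable \<P>"
  proof (rule Int_stableI)
    fix a b assume "a \<in> \<P>" "b \<in> \<P>"
    then obtain \<F>1 b1 \<F>2 b2 where 1: "a = ?cyl \<F>1 b1" "finite \<F>1 \<and> \<F>1 \<subseteq> sets E \<and> (\<forall>A\<in>\<F>1. A \<subseteq> S) \<and> (\<forall>A\<in>\<F>1. b1 A
      \<in> sets borel)"
      and 2: "b = ?cyl \<F>2 b2" "finite \<F>2 \<and> \<F>2 \<subseteq> sets E \<and> (\<forall>A\<in>\<F>2. A \<subseteq> S) \<and> (\<forall>A\<in>\<F>2. b2 A \<in> sets borel)"
      unfolding \<P>_def by blast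
    \<comment> \<open>A set that occurs in only one of the two cylinders is left unconstrained by
      the other, whence the value \<open>UNIV\<close>.\<close>
    let ?b = "\<lambda>A. (if A \<in> \<F>1 then b1 A else UNIV) \<inter> (if A \<in> \<F>2 then b2 A else UNIV)"
    have "a \<inter> b = ?cyl (\<F>1 \<union> \<F>2) ?b"
      unfolding 1 2 by (auto split: if_splits)
    moreover have "\<forall>A\<in>\<F>1 \<union> \<F>2. ?b A \<in> sets borel"
      using 1 2 by auto
    moreover have "finite (\<F>1 \<union> \<F>2)" "\<F>1 \<union> \<F>2 \<subseteq> sets E" "\<forall>A\<in>\<F>1 \<union> \<F>2. A \<subseteq> S"
      using 1 2 by auto
    ultimately show "a \<inter> b \<in> \<P>"
      unfolding \<P>_def by (intro CollectI exI[of _ "\<F>1 \<union> \<F>2"] exI[of _ ?b] conjI) assumption+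
  qed
  moreover have "Int_stable \<Q>"
  proof (rule Int_stableI)
    fix a b assume "a \<in> \<Q>" "b \<in> \<Q>"
    then obtain T1 T2 where "T1 \<in> sets borel" "T2 \<in> sets borel"
      "a = (\<lambda>\<omega>. emeasure (N \<omega>) B) -` T1 \<inter> space M" "b = (\<lambda>\<omega>. emeasure (N \<omega>) B) -` T2 \<inter> space M"
      unfolding \<Q>_def by blast
    then have "a \<inter> b = (\<lambda>\<omega>. emeasure (N \<omega>) B) -` (T1 \<inter> T2) \<inter> space M" "T1 \<inter> T2 \<in> sets borel"
      by auto
    then show "a \<inter> b \<in> \<Q>" unfolding \<Q>_def by blast
  qed
  moreover have "indep_set \<P> \<Q>"
  proof (rule indep_setI)
    show "\<P> \<subseteq> events"
    proof
      fix x assume "x \<in> \<P>"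
      then obtain \<F> b where x: "x = ?cyl \<F> b" "finite \<F>" "\<F> \<subseteq> sets E" "\<forall>A\<in>\<F>. b A \<in> sets borel"
        unfolding \<P>_def by blast
      have "{\<omega>\<in>space M. emeasure (N \<omega>) A \<in> b A} \<in> events" if "A \<in> \<F>" for A
        using that x by (intro measurable_sets_Collect[OF emeasure_N_measurable]) auto
      then show "x \<in> events"
        unfolding x(1) by (intro sets.sets_Collect_finite_All' sets.sets_Collect_finite_All x) auto
    qed
    show "\<Q> \<subseteq> events"
      unfolding \<Q>_def using emeasure_N_measurable[OF B] by (auto intro: measurable_sets)
    fix x y assume "x \<in> \<P>" "y \<in> \<Q>"
    then obtain \<F> b T where x: "x = ?cyl \<F> b" "finite \<F>" "\<F> \<subseteq> sets E" "\<And>A. A\<in>\<F> \<Longrightarrow> A \<subseteq> S" "\<forall>A\<in>\<F>. b A \<in> sets borel"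
      and y: "y = (\<lambda>\<omega>. emeasure (N \<omega>) B) -` T \<inter> space M" "T \<in> sets borel"
      unfolding \<P>_def \<Q>_def by blast
    obtain \<A> where A: "finite \<A>" "disjoint \<A>" "\<A> \<subseteq> sets E" "\<And>c. c \<in> \<A> \<Longrightarrow> c \<subseteq> S \<and> c \<noteq> {}"
      "\<And>A. A \<in> \<F> \<Longrightarrow> A = \<Union>{c\<in>\<A>. c \<subseteq> A}"
      using disjoint_refinement[OF x(2-4) S] by metis
    \<comment> \<open>Non-emptiness of the atoms covers the case \<open>B = {}\<close>, where
      disjointness from \<open>S\<close> alone would not separate \<open>B\<close> from
      them.\<close>
    have BA: "B \<notin> \<A>"
    proof
      assume "B \<in> \<A>"
      then have "B \<subseteq> S" "B \<noteq> {}" using A(4) by auto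
      then show False using SB by auto
    qed
    have "B \<inter> c = {}" if "c \<in> \<A>" for c
      using A(4)[OF that] SB by auto
    then have "disjoint (insert B \<A>)"
      using A(2) by (auto simp: disjoint_def)
    then have "indep_vars (\<lambda>_. borel) (\<lambda>A \<omega>. emeasure (N \<omega>) A) (insert B \<A>)"
      using prm A B by (simp add: poisson_random_measure_def)
    then have iv: "indep_var (PiM \<A> (\<lambda>_. borel)) (\<lambda>\<omega>. restrict (\<lambda>A. emeasure (N \<omega>) A) \<A>)
      (PiM {B} (\<lambda>_. borel)) (\<lambda>\<omega>. restrict (\<lambda>A. emeasure (N \<omega>) A) {B})"
      by (rule indep_var_restrict) (use BA in auto)
    \<comment> \<open>The cylinder becomes an event about the vector of atom counts, the count of
      each set being the sum over its atoms, and \<open>y\<close> an event about the count on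
      \<open>B\<close>.\<close>
    define X where "X = {v\<in>space (PiM \<A> (\<lambda>_. borel :: ennreal measure)). \<forall>A\<in>\<F>. (\<Sum>c\<in>{c\<in>\<A>. c \<subseteq> A}. v c) \<in> b A}"
    define Y where "Y = {v\<in>space (PiM {B} (\<lambda>_. borel :: ennreal measure)). v B \<in> T}"
    have X: "X \<in> sets (PiM \<A> (\<lambda>_. borel))"
    proof -
      have "{v\<in>space (PiM \<A> (\<lambda>_. borel :: ennreal measure)). (\<Sum>c\<in>{c\<in>\<A>. c \<subseteq> A}. v c) \<in> b A}
        \<in> sets (PiM \<A> (\<lambda>_. borel))" if "A \<in> \<F>" for A
        by (rule measurable_sets_Collect[where N=borel], rule borel_measurable_sum, rule measurable_component_singleton)
           (use x(5) that in auto)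
      then show ?thesis
        unfolding X_def by (intro sets.sets_Collect_finite_All' sets.sets_Collect_finite_All x) auto
    qed
    have Y: "Y \<in> sets (PiM {B} (\<lambda>_. borel))"
      unfolding Y_def by (rule measurable_sets_Collect[where N=borel], rule measurable_component_singleton) (use y in auto)
    have "emeasure (N \<omega>) A = (\<Sum>c\<in>{c\<in>\<A>. c \<subseteq> A}. emeasure (N \<omega>) c)" if "\<omega> \<in> space M" "A \<in> \<F>" for A \<omega>
    proof -
      have "emeasure (N \<omega>) A = emeasure (N \<omega>) (\<Union>{c\<in>\<A>. c \<subseteq> A})"
        using A(5)[OF that(2)] by simp
      also have "\<dots> = (\<Sum>c\<in>{c\<in>\<A>. c \<subseteq> A}. emeasure (N \<omega>) c)"
        using A(1-3) sum_emeasure[of "\<lambda>c. c" "{c\<in>\<A>. c \<subseteq> A}" "N \<omega>"] sets_N[OF that(1)]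
        by (subst sum_emeasure) (auto simp: disjoint_family_on_def disjoint_def)
      finally show ?thesis .
    qed
    then have ex: "x = (\<lambda>\<omega>. restrict (\<lambda>A. emeasure (N \<omega>) A) \<A>) -` X \<inter> space M"
      unfolding x(1) X_def by (auto simp: space_PiM)
    have ey: "y = (\<lambda>\<omega>. restrict (\<lambda>A. emeasure (N \<omega>) A) {B}) -` Y \<inter> space M"
      unfolding y(1) Y_def by (auto simp: space_PiM)
    have "x \<inter> y = (\<lambda>\<omega>. (restrict (\<lambda>A. emeasure (N \<omega>) A) \<A>, restrict (\<lambda>A. emeasure (N \<omega>) A) {B})) -` (X \<times> Y) \<inter> space M"
      unfolding ex ey by auto
    then show "prob (x \<inter> y) = prob x * prob y"
      using indep_varD[OF iv X Y] ex ey by simp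
  qed
  ultimately have ind: "indep_set (sigma_sets (space M) \<P>) (sigma_sets (space M) \<Q>)"
    by (intro indep_set_sigma_sets)
  have "history S \<subseteq> \<P>"
  proof
    fix x assume "x \<in> history S"
    then obtain A T where "x = (\<lambda>\<omega>. emeasure (N \<omega>) A) -` T \<inter> space M" "A \<in> sets E" "A \<subseteq> S" "T \<in> sets borel"
      unfolding history_def by blast
    then have "x = ?cyl {A} (\<lambda>_. T)" "finite {A} \<and> {A} \<subseteq> sets E \<and> (\<forall>A\<in>{A}. A \<subseteq> S) \<and> (\<forall>A\<in>{A}. T \<in> sets borel)"
      by auto
    then show "x \<in> \<P>" unfolding \<P>_def by (intro CollectI exI[of _ "{A}"] exI[of _ "\<lambda>_. T"]) simp
  qed
  then have "A \<in> sigma_sets (space M) \<P>"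
    using A sigma_sets_mono' by blast
  moreover have "(\<lambda>\<omega>. emeasure (N \<omega>) B) -` T \<inter> space M \<in> sigma_sets (space M) \<Q>"
    using T by (intro sigma_sets.Basic) (auto simp: \<Q>_def)
  ultimately show ?thesis
    using indep_setD[OF ind] by blast
qed

lemma history_subset_events: "S \<in> sets E \<Longrightarrow> sigma_sets (space M) (history S) \<subseteq> events"
  by (intro sets.sigma_sets_subset) (auto simp: history_def intro: measurable_sets[OF emeasure_N_measurable])

text \<open>Independence is rephrased as an equality of laws: restricting the probability to
  \<open>A\<close> multiplies the law of the count on \<open>B\<close> by the probability of
  \<open>A\<close>. Integrating the identity function against both laws gives the product.\<close>

lemma history_mean_N:
  assumes S: "S \<in> sets E" and B: "B \<in> sets E" and SB: "S \<inter> B = {}"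
    and A: "A \<in> sigma_sets (space M) (history S)"
  shows "(\<integral>\<^sup>+\<omega>. indicator A \<omega> * emeasure (N \<omega>) B \<partial>M) = emeasure M A * emeasure E B"
proof -
  have A'[measurable]: "A \<in> events"
    using history_subset_events[OF S] A by blast
  note [measurable] = emeasure_N_measurable[OF B]
  have "distr (density M (indicator A)) borel (\<lambda>\<omega>. emeasure (N \<omega>) B)
    = scale_measure (emeasure M A) (distr M borel (\<lambda>\<omega>. emeasure (N \<omega>) B))"
  proof (rule measure_eqI)
    fix T assume "T \<in> sets (distr (density M (indicator A)) borel (\<lambda>\<omega>. emeasure (N \<omega>) B))"
    then have T[measurable]: "T \<in> sets borel" by simp
    have "emeasure (distr (density M (indicator A)) borel (\<lambda>\<omega>. emeasure (N \<omega>) B)) T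
      = emeasure M (A \<inter> ((\<lambda>\<omega>. emeasure (N \<omega>) B) -` T \<inter> space M))"
      by (simp add: emeasure_distr emeasure_density flip: indicator_inter_arith)
    also have "\<dots> = emeasure M A * emeasure M ((\<lambda>\<omega>. emeasure (N \<omega>) B) -` T \<inter> space M)"
      using indep_history[OF S B SB A T] by (simp add: emeasure_eq_measure ennreal_mult)
    finally show "emeasure (distr (density M (indicator A)) borel (\<lambda>\<omega>. emeasure (N \<omega>) B)) T
      = emeasure (scale_measure (emeasure M A) (distr M borel (\<lambda>\<omega>. emeasure (N \<omega>) B))) T"
      by (simp add: emeasure_distr)
  qed simp
  then have "(\<integral>\<^sup>+x. x \<partial>distr (density M (indicator A)) borel (\<lambda>\<omega>. emeasure (N \<omega>) B))
    = emeasure M A * (\<integral>\<^sup>+x. x \<partial>distr M borel (\<lambda>\<omega>. emeasure (N \<omega>) B))"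
    by (simp add: nn_integral_scale_measure)
  then show ?thesis
    by (simp add: nn_integral_distr nn_integral_density mean_N[OF B])
qed

lemma history_nn_integral_mean_N:
  assumes "S \<in> sets E" "R \<in> sets E" "S \<inter> R = {}"
    and "A \<in> sigma_sets (space M) (history S)" and "f \<in> borel_measurable E"
  shows "(\<integral>\<^sup>+\<omega>. indicator A \<omega> * (\<integral>\<^sup>+z. f z * indicator R z \<partial>N \<omega>) \<partial>M) = emeasure M A * (\<integral>\<^sup>+z. f z * indicator R z \<partial>E)"
proof (rule random_measure_nn_integral_mean[OF sets_N])
  show "(\<lambda>\<omega>. indicator A \<omega> :: ennreal) \<in> borel_measurable M"
    using assms(4) history_subset_events[OF assms(1)] by (intro borel_measurable_indicator) blast
  show "(\<integral>\<^sup>+\<omega>. indicator A \<omega> * emeasure (N \<omega>) B \<partial>M) = emeasure M A * emeasure E B"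
    if "B \<in> sets E" "B \<subseteq> R" for B
    using assms(3) that by (intro history_mean_N[OF assms(1) that(1) _ assms(4)]) auto
qed (use assms in simp_all)

end

section \<open>The predictable sigma-algebra\<close>

lemma predictable_generator_Pow:
  assumes "filtration \<Omega> F"
  shows "{{s<..t} \<times> B \<times> A | s t B A. 0 \<le> (s::real) \<and> s < t \<and> B \<in> sets S \<and> A
    \<in> sets (F s)} \<subseteq> Pow ({0<..} \<times> space S \<times> \<Omega>)"
proof -
  interpret filtration \<Omega> F by fact
  have "A \<subseteq> \<Omega>" if "A \<in> sets (F s)" for s A
    using sets.sets_into_space[OF that] by (simp add: space_F)
  then show ?thesis using sets.sets_into_space[of _ S] by fastforce
qed

locale poisson_noise = prob_space M for M :: "'w measure" +
  fixes \<mu> :: "'d::euclidean_space measure" and N :: "'w \<Rightarrow> (real \<times> 'd \<times> 'd) measure"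
  assumes levy: "levy_measure \<mu>" and noise: "poisson_random_measure M (noise_intensity \<mu>) N"

sublocale poisson_noise \<subseteq> poisson_rm M "noise_intensity \<mu>" N
  by unfold_locales (rule noise)

sublocale poisson_noise \<subseteq> filt: filtration "space M" "noise_filtration M \<mu> N"
  by (rule filtration_noise_filtration)

context poisson_noise
begin

abbreviation "E \<equiv> noise_intensity \<mu>"
abbreviation "F \<equiv> noise_filtration M \<mu> N"
abbreviation "Pred S \<equiv> predictable_sigma (space M) F S"
abbreviation "PredE \<equiv> Pred (borel :: ('d \<times> 'd) measure)"

lemma sets_mu[measurable_cong]: "sets \<mu> = sets borel"
  using levy by (simp add: levy_measure_def)

lemma sets_E[measurable_cong]: "sets E = sets (restrict_space borel {0..} \<Otimes>\<^sub>M borel)"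
proof -
  have "sets (restrict_space lborel {0::real..}) = sets (restrict_space borel {0..})"
    by (rule sets_restrict_space_cong) simp
  moreover have "sets (lborel \<Otimes>\<^sub>M \<mu>) = sets (borel :: ('d \<times> 'd) measure)"
    unfolding borel_prod[symmetric] by (intro sets_pair_measure_cong sets_lborel sets_mu)
  ultimately show ?thesis
    unfolding noise_intensity_def by (rule sets_pair_measure_cong)
qed

lemma measurable_fst_E[measurable]: "fst \<in> borel_measurable E"
proof -
  have "fst \<in> measurable E (restrict_space borel {0..})"
    by measurable
  then show ?thesis by (simp add: measurable_restrict_space2_iff)
qed

lemma space_F: "space (F t) = space M"
  by (rule filt.space_F)

lemma Times_in_sets_E:
  assumes "I \<in> sets borel" "D \<in> sets borel" "I \<subseteq> {0..}"
  shows "I \<times> D \<in> sets E"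
  unfolding sets_E using assms by (intro pair_measureI) (auto simp: sets_restrict_space)

lemma sets_F: "sets (F t) = sigma_sets (space M) (history ({0..t} \<times> UNIV))"
  unfolding noise_filtration_def history_def by (rule sets_measure_of) auto

lemma sets_F_subset: "sets (F t) \<subseteq> events"
  unfolding sets_F by (intro history_subset_events Times_in_sets_E) auto

lemma nn_integral_N_F_measurable:
  assumes f: "f \<in> borel_measurable E" and S: "S \<in> sets E" "S \<subseteq> {0..t} \<times> UNIV"
  shows "(\<lambda>\<omega>. \<integral>\<^sup>+z. f z * indicator S z \<partial>N \<omega>) \<in> borel_measurable (F t)"
proof (rule random_measure_nn_integral_measurable[OF _ S(1) _ f])
  show "sets (N \<omega>) = sets E" if "\<omega> \<in> space (F t)" for \<omega>
    using that sets_N by (simp add: space_F)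
  fix A assume A: "A \<in> sets E" "A \<subseteq> S"
  show "(\<lambda>\<omega>. emeasure (N \<omega>) A) \<in> borel_measurable (F t)"
  proof (rule measurableI)
    fix B assume B: "B \<in> sets (borel :: ennreal measure)"
    have "(\<lambda>\<omega>. emeasure (N \<omega>) A) -` B \<inter> space M \<in> history ({0..t} \<times> UNIV)"
      unfolding history_def using A S(2) B by blast
    then show "(\<lambda>\<omega>. emeasure (N \<omega>) A) -` B \<inter> space (F t) \<in> sets (F t)"
      unfolding sets_F space_F by (rule sigma_sets.Basic)
  qed simp
qed

definition gen :: "'s measure \<Rightarrow> (real \<times> 's \<times> 'w) set set" where
  "gen S = {{s<..t} \<times> B \<times> A | s t B A. 0 \<le> s \<and> s < t \<and> B \<in> sets S \<and> A \<in> sets (F s)}"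

lemma gen_Pow: "gen S \<subseteq> Pow ({0<..} \<times> space S \<times> space M)"
  unfolding gen_def by (rule predictable_generator_Pow) unfold_locales

lemma sets_Pred: "sets (Pred S) = sigma_sets ({0<..} \<times> space S \<times> space M) (gen S)"
  using gen_Pow unfolding predictable_sigma_def gen_def by (rule sets_measure_of)

lemma space_Pred: "space (Pred S) = {0<..} \<times> space S \<times> space M"
  using gen_Pow unfolding predictable_sigma_def gen_def by (rule space_measure_of)

lemma gen_in_Pred:
  "0 \<le> s \<Longrightarrow> s < t \<Longrightarrow> B \<in> sets S \<Longrightarrow> A \<in> sets (F s) \<Longrightarrow> {s<..t} \<times> B \<times> A \<in> sets (Pred S)"
  unfolding sets_Pred gen_def by (rule sigma_sets.Basic) blast

lemma gen_ray_in_Pred: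
  assumes "0 \<le> s" "B \<in> sets S" "A \<in> sets (F s)"
  shows "{s<..} \<times> B \<times> A \<in> sets (Pred S)"
proof -
  have "{s<..} \<times> B \<times> A = (\<Union>n::nat. {s<..s + 1 + real n} \<times> B \<times> A)"
  proof -
    have "\<exists>n::nat. t \<le> s + 1 + real n" for t
    proof -
      obtain n where "t - s - 1 \<le> real n" using real_arch_simple by blast
      then show ?thesis by (intro exI[of _ n]) simp
    qed
    then show ?thesis by auto
  qed
  also have "\<dots> \<in> sets (Pred S)"
    using assms by (intro sets.countable_UN) (auto intro!: gen_in_Pred)
  finally show ?thesis .
qed

text \<open>The intersection of two rectangles starts at the later of the two left ends, and by then
  both events belong to the filtration.\<close>

lemma Int_stable_gen: "Int_stable (gen S)"
proof (rule Int_stableI)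
  fix a b assume "a \<in> gen S" "b \<in> gen S"
  then obtain s t B A s' t' B' A' where
    a: "a = {s<..t} \<times> B \<times> A" "0 \<le> s" "s < t" "B \<in> sets S" "A \<in> sets (F s)" and
    b: "b = {s'<..t'} \<times> B' \<times> A'" "0 \<le> s'" "s' < t'" "B' \<in> sets S" "A' \<in> sets (F s')"
    unfolding gen_def by blast
  have ab: "a \<inter> b = {max s s'<..min t t'} \<times> (B \<inter> B') \<times> (A \<inter> A')"
    unfolding a b by auto
  have "A \<in> sets (F (max s s'))" "A' \<in> sets (F (max s s'))"
    using a b filt.sets_F_mono[of s "max s s'"] filt.sets_F_mono[of s' "max s s'"] by auto
  then have *: "B \<inter> B' \<in> sets S" "A \<inter> A' \<in> sets (F (max s s'))" "0 \<le> max s s'"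
    using a b by auto
  show "a \<inter> b \<in> gen S"
  proof (cases "max s s' < min t t'")
    case True
    with * show ?thesis unfolding ab gen_def by blast
  next
    case False
    \<comment> \<open>A generator needs \<open>s < t\<close>, so the empty set is written with a
      non-empty time interval and empty other factors.\<close>
    then have "a \<inter> b = {0<..1} \<times> {} \<times> {}" unfolding ab by auto
    moreover have "{0<..1::real} \<times> ({} :: 's set) \<times> ({} :: 'w set) \<in> gen S" for S :: "'s measure"
      unfolding gen_def by (intro CollectI exI[of _ 0] exI[of _ 1] exI[of _ "{}"]) auto
    ultimately show ?thesis by (simp only:)
  qed
qed

lemma measurable_into_Pred:
  assumes "f \<in> space L \<rightarrow> {0<..} \<times> space S \<times> space M"
    and "\<And>s t B A. 0 \<le> s \<Longrightarrow> s < t \<Longrightarrow> B \<in> sets S \<Longrightarrow> A \<in> sets (F s) \<Longrightarrow>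
      f -` ({s<..t} \<times> B \<times> A) \<inter> space L \<in> sets L"
  shows "f \<in> measurable L (Pred S)"
  using sets_Pred gen_Pow assms(1)
proof (rule measurable_sigma_sets)
  show "f -` y \<inter> space L \<in> sets L" if "y \<in> gen S" for y
    using that assms(2) unfolding gen_def by blast
qed

lemma measurable_fst_Pred[measurable]: "fst \<in> borel_measurable (Pred S)"
proof (rule borel_measurableI_greater)
  fix y :: real
  have "{w \<in> space (Pred S). y < fst w} = {max 0 y<..} \<times> space S \<times> space M"
    unfolding space_Pred by auto
  moreover have "space M \<in> sets (F (max 0 y))"
    using sets.top[of "F (max 0 y)"] by (simp add: space_F)
  ultimately show "{w \<in> space (Pred S). y < fst w} \<in> sets (Pred S)"
    by (auto intro!: gen_ray_in_Pred)
qed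

lemma measurable_param_Pred[measurable]: "(\<lambda>w. fst (snd w)) \<in> measurable (Pred S) S"
proof (rule measurableI)
  show "fst (snd w) \<in> space S" if "w \<in> space (Pred S)" for w
    using that by (auto simp: space_Pred)
  fix B assume B: "B \<in> sets S"
  have "(\<lambda>w. fst (snd w)) -` B \<inter> space (Pred S) = {0<..} \<times> B \<times> space M"
    using sets.sets_into_space[OF B] by (auto simp: space_Pred)
  moreover have "space M \<in> sets (F 0)"
    using sets.top[of "F 0"] by (simp add: space_F)
  ultimately show "(\<lambda>w. fst (snd w)) -` B \<inter> space (Pred S) \<in> sets (Pred S)"
    using B by (auto intro!: gen_ray_in_Pred)
qed

lemma measurable_point_Pred:
  "(\<lambda>w. (fst w, fst (snd w))) \<in> measurable PredE E"
proof -
  have "fst \<in> measurable PredE (restrict_space borel {0..})"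
    by (rule measurable_restrict_space2) (auto simp: space_Pred)
  then show ?thesis
    unfolding measurable_cong_sets[OF refl sets_E] by measurable
qed

text \<open>Forgets the jump size: a predictable field in (s, y) is also predictable over the larger
  parameter (y, h), which makes \<open>\<sigma> (u s y \<omega>) h\<close> an admissible
  integrand.\<close>

lemma measurable_drop_Pred:
  "(\<lambda>w. (fst w, fst (fst (snd w)), snd (snd w))) \<in> measurable PredE (Pred (borel :: 'd measure))"
proof (rule measurable_into_Pred)
  fix s t :: real and B :: "'d set" and A assume st: "0 \<le> s" "s < t" and B: "B \<in> sets borel" and A: "A \<in> sets (F s)"
  have "(\<lambda>w. (fst w, fst (fst (snd w)), snd (snd w))) -` ({s<..t} \<times> B \<times> A) \<inter> space PredE = {s<..t} \<times> (B \<times> UNIV) \<times> A"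
    using st A sets.sets_into_space[OF A] by (auto simp: space_Pred space_F)
  moreover have "B \<times> UNIV \<in> sets (borel :: ('d \<times> 'd) measure)"
    unfolding borel_prod[symmetric] using B by (intro pair_measureI) auto
  ultimately show "(\<lambda>w. (fst w, fst (fst (snd w)), snd (snd w))) -` ({s<..t} \<times> B \<times> A) \<inter> space PredE \<in> sets PredE"
    using st A by (auto intro!: gen_in_Pred)
qed (auto simp: space_Pred)

text \<open>A predictable field at a fixed time and place is a random variable. Time must be
  positive because the predictable space starts after 0.\<close>

lemma measurable_section_Pred:
  assumes "0 < t" "x \<in> space S"
  shows "(\<lambda>\<omega>. (t, x, \<omega>)) \<in> measurable M (Pred S)"
proof (rule measurable_into_Pred)
  fix s t' B A assume "A \<in> sets (F s)"
  then have A: "A \<in> events" using sets_F_subset by blast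
  have "(\<lambda>\<omega>. (t, x, \<omega>)) -` ({s<..t'} \<times> B \<times> A) \<inter> space M = (if s < t \<and> t \<le> t' \<and> x \<in> B then A else {})"
    using sets.sets_into_space[OF A] by auto
  then show "(\<lambda>\<omega>. (t, x, \<omega>)) -` ({s<..t'} \<times> B \<times> A) \<inter> space M \<in> events"
    using A by simp
qed (use assms in auto)

(* The points of E at time 0 do not belong to the space of PredE and are moved to time 1; they are
   never charged by the integrals below. *)
definition emb :: "'w \<Rightarrow> real \<times> 'd \<times> 'd \<Rightarrow> real \<times> ('d \<times> 'd) \<times> 'w" where
  "emb \<omega> z = (if 0 < fst z then fst z else 1, snd z, \<omega>)"

text \<open>Since each \<open>F s\<close> consists of events, the predictable sigma-algebra is
  coarser than the product one; predictable integrands can therefore be integrated by Fubini over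
  intensity and probability.\<close>

lemma measurable_emb_pair: "(\<lambda>(z, \<omega>). emb \<omega> z) \<in> measurable (E \<Otimes>\<^sub>M M) PredE"
proof (rule measurable_into_Pred)
  fix s t :: real and B :: "('d \<times> 'd) set" and A assume st: "0 \<le> s" "s < t" and B[measurable]: "B \<in> sets borel"
    and A: "A \<in> sets (F s)"
  have [measurable]: "A \<in> events" using A sets_F_subset by blast
  have "(\<lambda>(z, \<omega>). emb \<omega> z) -` ({s<..t} \<times> B \<times> A) \<inter> space (E \<Otimes>\<^sub>M M) =
    {w\<in>space (E \<Otimes>\<^sub>M M). (if 0 < fst (fst w) then fst (fst w) else 1) \<in> {s<..t} \<and> snd (fst w) \<in> B \<and> snd w \<in> A}"
    by (auto simp: emb_def)
  also have "\<dots> \<in> sets (E \<Otimes>\<^sub>M M)" by measurable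
  finally show "(\<lambda>(z, \<omega>). emb \<omega> z) -` ({s<..t} \<times> B \<times> A) \<inter> space (E \<Otimes>\<^sub>M M) \<in> sets (E \<Otimes>\<^sub>M M)" .
qed (auto simp: emb_def space_pair_measure)

lemma measurable_emb: "\<omega> \<in> space M \<Longrightarrow> emb \<omega> \<in> measurable E PredE"
  using measurable_compose[OF measurable_Pair2' measurable_emb_pair] by simp

section \<open>Predictability of integrals over the past\<close>

text \<open>The preimage of \<open>T\<close> consists of a ray starting strictly after
  \<open>r\<close> over an event of \<open>F r\<close>, and of all points up to time
  \<open>r\<close> when \<open>T\<close> contains the value 0 taken there.\<close>

lemma predictable_delayed:
  fixes f :: "'w \<Rightarrow> ennreal"
  assumes r: "0 \<le> r" and f: "f \<in> borel_measurable (F r)"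
  shows "(\<lambda>(t, x, \<omega>). if r < t then f \<omega> else 0) \<in> borel_measurable (Pred S)"
proof (rule measurableI)
  fix T :: "ennreal set" assume T: "T \<in> sets borel"
  let ?g = "\<lambda>(t, x, \<omega>). if r < t then f \<omega> else 0"
  have "?g -` T \<inter> space (Pred S) = ({r<..} \<times> space S \<times> (f -` T \<inter> space M)) \<union>
    (if 0 \<in> T then {w\<in>space (Pred S). fst w \<le> r} else {})"
    using r by (auto simp: space_Pred split: if_splits)
  moreover have "{r<..} \<times> space S \<times> (f -` T \<inter> space M) \<in> sets (Pred S)"
    using measurable_sets[OF f T] by (intro gen_ray_in_Pred r) (auto simp: space_F)
  moreover have "{w\<in>space (Pred S). fst w \<le> r} \<in> sets (Pred S)"
    by measurable
  ultimately show "?g -` T \<inter> space (Pred S) \<in> sets (Pred S)"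
    by auto
qed simp

(* The open upper end makes the process left-continuous in t; it is the supremum over rational
   r < t of F r-measurable variables that are switched on after time r. *)
lemma predictable_history_integral:
  assumes f: "f \<in> borel_measurable E" and D: "D \<in> sets E" "D \<subseteq> {a<..} \<times> UNIV"
    and a: "0 \<le> a" and A: "A \<in> sets (F a)"
  shows "(\<lambda>(t, x, \<omega>). indicator A \<omega> * (\<integral>\<^sup>+z. f z * indicator (D \<inter> {..<t} \<times> UNIV) z \<partial>N \<omega>)) \<in> borel_measurable (Pred S)"
proof -
  define I where "I r \<omega> = indicator A \<omega> * (\<integral>\<^sup>+z. f z * indicator (D \<inter> {..r} \<times> UNIV) z \<partial>N \<omega>)" for r \<omega>
  have D_meas: "D \<inter> {..r} \<times> UNIV \<in> sets E" for r
  proof -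
    have "{z\<in>space E. z \<in> D \<and> fst z \<le> r} \<in> sets E" using D(1) by measurable
    also have "{z\<in>space E. z \<in> D \<and> fst z \<le> r} = D \<inter> {..r} \<times> UNIV"
      using sets.sets_into_space[OF D(1)] by auto
    finally show ?thesis .
  qed
  have "(\<lambda>(t, x, \<omega>). if r < t then I r \<omega> else 0) \<in> borel_measurable (Pred S)" if r: "a < r" for r
  proof (rule predictable_delayed)
    have "A \<in> sets (F r)" using A filt.sets_F_mono[of a r] r by auto
    moreover have "(\<lambda>\<omega>. \<integral>\<^sup>+z. f z * indicator (D \<inter> {..r} \<times> UNIV) z \<partial>N \<omega>) \<in> borel_measurable (F r)"
      using D a by (intro nn_integral_N_F_measurable f D_meas) auto
    ultimately show "I r \<in> borel_measurable (F r)"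
      unfolding I_def by measurable
  qed (use a r in simp)
  then have "(\<lambda>w. SUP r\<in>{r\<in>\<rat>. a < r}. (\<lambda>(t, x, \<omega>). if r < t then I r \<omega> else 0) w) \<in> borel_measurable (Pred S)"
    by (intro borel_measurable_SUP countable_subset[OF _ countable_rat]) auto
  also have "?this \<longleftrightarrow> ?thesis"
  proof (intro measurable_cong)
    fix w assume "w \<in> space (Pred S)"
    then obtain t x \<omega> where w: "w = (t, x, \<omega>)" "\<omega> \<in> space M"
      by (auto simp: space_Pred)
    note [measurable_cong] = sets_N[OF w(2)]
    have "(SUP r\<in>{r\<in>\<rat>. a < r}. if r < t then I r \<omega> else 0) =
      indicator A \<omega> * (\<integral>\<^sup>+z. f z * indicator (D \<inter> {..<t} \<times> UNIV) z \<partial>N \<omega>)" (is "?L = _ * ?R")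
    proof (rule antisym)
      show "?L \<le> indicator A \<omega> * ?R"
        unfolding I_def
        by (intro SUP_least) (auto intro!: mult_left_mono nn_integral_mono split: split_indicator)
      show "indicator A \<omega> * ?R \<le> ?L"
      proof (cases "a < t")
        case False
        \<comment> \<open>Nothing in \<open>D\<close> happens before time \<open>a\<close>, so at
          times \<open>t \<le> a\<close> the integral is over the empty set.\<close>
        then have "D \<inter> {..<t} \<times> UNIV = {}" using D(2) by force
        then show ?thesis by simp
      next
        case True
        \<comment> \<open>A sequence increasing to \<open>t\<close>; the 2 in the denominator keeps
          it strictly above \<open>a\<close> already for n = 0.\<close>
        define u where "u n = t - (t - a) / (real n + 2)" for n :: nat
        have u: "a < u n" "u n < t" for n
        proof -
          have "(t - a) / (real n + 2) < (t - a) / 1"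
            using True by (intro divide_strict_left_mono) auto
          then show "a < u n" "u n < t"
            using True by (auto simp: u_def)
        qed
        have "incseq u"
          using True unfolding u_def incseq_def by (auto intro!: divide_left_mono mult_pos_pos add_nonneg_pos)
        have lim: "u \<longlonglongrightarrow> t"
          unfolding u_def by real_asymp
        have "indicator (D \<inter> {..<t} \<times> UNIV) z = (SUP n. indicator (D \<inter> {..u n} \<times> UNIV) z :: ennreal)" for z
        proof (rule antisym)
          show "indicator (D \<inter> {..<t} \<times> UNIV) z \<le> (SUP n. indicator (D \<inter> {..u n} \<times> UNIV) z :: ennreal)"
          proof (cases "z \<in> D \<inter> {..<t} \<times> UNIV")
            case True
            then have "\<forall>\<^sub>F n in sequentially. fst z < u n"
              by (intro order_tendstoD(1)[OF lim]) auto
            then obtain n where "fst z < u n"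
              by (auto dest: eventually_happens)
            then show ?thesis
              using True by (intro SUP_upper2[of n]) (auto simp: indicator_def)
          qed simp
          show "(SUP n. indicator (D \<inter> {..u n} \<times> UNIV) z) \<le> (indicator (D \<inter> {..<t} \<times> UNIV) z :: ennreal)"
            using u(2) by (intro SUP_least) (auto split: split_indicator intro: le_less_trans)
        qed
        then have "?R = (\<integral>\<^sup>+z. (SUP n. f z * indicator (D \<inter> {..u n} \<times> UNIV) z) \<partial>N \<omega>)"
          by (simp add: SUP_mult_left_ennreal)
        also have "\<dots> = (SUP n. \<integral>\<^sup>+z. f z * indicator (D \<inter> {..u n} \<times> UNIV) z \<partial>N \<omega>)"
        proof (rule nn_integral_monotone_convergence_SUP)
          show "incseq (\<lambda>n z. f z * indicator (D \<inter> {..u n} \<times> UNIV) z)"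
            using \<open>incseq u\<close>
            by (auto simp: incseq_def le_fun_def split: split_indicator intro!: mult_left_mono intro: order_trans)
          show "(\<lambda>z. f z * indicator (D \<inter> {..u n} \<times> UNIV) z) \<in> borel_measurable (N \<omega>)" for n
            using f D_meas[of "u n"] by measurable
        qed
        finally have "indicator A \<omega> * ?R = (SUP n. I (u n) \<omega>)"
          by (simp add: I_def SUP_mult_left_ennreal)
        also have "\<dots> \<le> ?L"
        proof (rule SUP_least)
          fix n
          \<comment> \<open>The supremum runs over rational times, to keep it countable, so
            \<open>u n\<close> is dominated by a rational time before \<open>t\<close>.\<close>
          obtain q where q: "q \<in> \<rat>" "u n < q" "q < t"
            using Rats_dense_in_real[OF u(2)] by blast
          have "I (u n) \<omega> \<le> I q \<omega>"
            unfolding I_def using q by (auto intro!: mult_left_mono nn_integral_mono split: split_indicator)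
          also have "\<dots> \<le> ?L"
            using q u(1)[of n] by (intro SUP_upper2[of q]) auto
          finally show "I (u n) \<omega> \<le> ?L" .
        qed
        finally show ?thesis .
      qed
    qed
    then show "(SUP r\<in>{r\<in>\<rat>. a < r}. (\<lambda>(t, x, \<omega>). if r < t then I r \<omega> else 0) w) =
      (\<lambda>(t, x, \<omega>). indicator A \<omega> * (\<integral>\<^sup>+z. f z * indicator (D \<inter> {..<t} \<times> UNIV) z \<partial>N \<omega>)) w"
      by (simp add: w)
  qed
  finally show ?thesis .
qed

end

section \<open>Integrals of predictable fields\<close>

context poisson_noise
begin

section \<open>The reweighted noise as a predictable kernel\<close>

text \<open>Sigma-finiteness of the intensity supplies a strictly positive and finite function of
  finite integral. Finiteness tames the noise, and positivity allows the weight to be divided out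
  again.\<close>

definition weight :: "real \<times> 'd \<times> 'd \<Rightarrow> ennreal" where
  "weight = (SOME h. h \<in> borel_measurable E \<and> integral\<^sup>N E h \<noteq> \<infinity> \<and> (\<forall>z\<in>space E. 0 < h z \<and> h z < \<infinity>))"

lemma
  shows weight_measurable[measurable]: "weight \<in> borel_measurable E"
    and weight_integral: "integral\<^sup>N E weight < \<infinity>"
    and weight_pos: "z \<in> space E \<Longrightarrow> 0 < weight z"
    and weight_finite: "z \<in> space E \<Longrightarrow> weight z < \<infinity>"
proof -
  interpret sigma_finite_measure E
    using noise by (simp add: poisson_random_measure_def)
  have "\<exists>h. h \<in> borel_measurable E \<and> integral\<^sup>N E h \<noteq> \<infinity> \<and> (\<forall>z\<in>space E. 0 < h z \<and> h z < \<infinity>)"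
    using Ex_finite_integrable_function by blast
  from someI_ex[OF this, folded weight_def]
  show "weight \<in> borel_measurable E" "integral\<^sup>N E weight < \<infinity>"
    "z \<in> space E \<Longrightarrow> 0 < weight z" "z \<in> space E \<Longrightarrow> weight z < \<infinity>"
    by (auto simp: less_top[symmetric])
qed

text \<open>Time 0 lies outside the predictable space, and leaving out time \<open>t\<close> makes
  the noise on the slab left-continuous in \<open>t\<close>, hence predictable.\<close>

abbreviation slab :: "real \<Rightarrow> (real \<times> 'd \<times> 'd) set" where
  "slab t \<equiv> {0<..<t} \<times> UNIV"

lemma slab_in_E[measurable]: "slab t \<in> sets E"
  by (rule Times_in_sets_E) auto

lemma space_N: "\<omega> \<in> space M \<Longrightarrow> space (N \<omega>) = space E"
  by (rule sets_eq_imp_space_eq[OF sets_N])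

definition mass :: "real \<Rightarrow> 'w \<Rightarrow> ennreal" where
  "mass t \<omega> = (\<integral>\<^sup>+z. weight z * indicator (slab t) z \<partial>N \<omega>)"

lemma mass_predictable[measurable]: "(\<lambda>(t, x, \<omega>). mass t \<omega>) \<in> borel_measurable (Pred S)"
proof -
  have "(\<lambda>(t, x, \<omega>). indicator (space M) \<omega> * (\<integral>\<^sup>+z. weight z * indicator (({0<..} \<times> UNIV) \<inter> {..<t} \<times> UNIV) z \<partial>N \<omega>))
    \<in> borel_measurable (Pred S)"
    by (rule predictable_history_integral)
       (use sets.top[of "F 0"] in \<open>auto intro!: Times_in_sets_E simp: space_F\<close>)
  also have "?this \<longleftrightarrow> ?thesis"
  proof (rule measurable_cong)
    fix w assume "w \<in> space (Pred S)"
    moreover have "({0<..} \<times> UNIV) \<inter> {..<t} \<times> UNIV = slab t" for t by auto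
    ultimately show "(\<lambda>(t, x, \<omega>). indicator (space M) \<omega> * (\<integral>\<^sup>+z. weight z *
      indicator (({0<..} \<times> UNIV) \<inter> {..<t} \<times> UNIV) z \<partial>N \<omega>)) w
       = (\<lambda>(t, x, \<omega>). mass t \<omega>) w"
      by (auto simp: space_Pred mass_def)
  qed
  finally show ?thesis .
qed

text \<open>One null set serves all \<open>t\<close> at once, because every
  \<open>mass t \<omega>\<close> is at most the total weighted mass, whose mean is the integral of
  \<open>weight\<close> against the intensity.\<close>

lemma AE_mass_finite: "AE \<omega> in M. \<forall>t. mass t \<omega> < \<infinity>"
proof -
  have "(\<integral>\<^sup>+\<omega>. (\<integral>\<^sup>+z. weight z \<partial>N \<omega>) \<partial>M) < \<infinity>"
    using weight_integral by (simp add: nn_integral_mean_N)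
  then have "AE \<omega> in M. (\<integral>\<^sup>+z. weight z \<partial>N \<omega>) \<noteq> \<infinity>"
    by (intro nn_integral_PInf_AE nn_integral_N_measurable) auto
  then show ?thesis
  proof eventually_elim
    case (elim \<omega>)
    have "mass t \<omega> \<le> (\<integral>\<^sup>+z. weight z \<partial>N \<omega>)" for t
      unfolding mass_def by (intro nn_integral_mono) (auto split: split_indicator)
    with elim show ?case by (auto simp: less_top intro: le_less_trans)
  qed
qed

(* N \<omega> need not be sigma-finite for every \<omega>. Weighting it so that it is almost surely finite, and
   normalising, gives a subprobability kernel, to which the Giry monad applies; the exceptional
   \<omega> are sorted out by the predictable condition mass t \<omega> < \<infinity>, because the filtration is
   not augmented. *)
definition kern :: "real \<Rightarrow> 'w \<Rightarrow> (real \<times> ('d \<times> 'd) \<times> 'w) measure" where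
  "kern t \<omega> = (if 0 < mass t \<omega> \<and> mass t \<omega> < \<infinity>
     then scale_measure (inverse (mass t \<omega>))
       (distr (density (N \<omega>) (\<lambda>z. weight z * indicator (slab t) z)) PredE (emb \<omega>))
     else null_measure PredE)"

lemma sets_kern: "sets (kern t \<omega>) = sets PredE"
  by (simp add: kern_def)

lemma ennreal_mult_inverse:
  fixes a :: ennreal
  shows "0 < a \<Longrightarrow> a < \<infinity> \<Longrightarrow> a * inverse a = 1"
  using ennreal_divide_self[of a] by (simp add: divide_ennreal_def less_top)

lemma nn_integral_kern:
  assumes \<omega>: "\<omega> \<in> space M" and f: "f \<in> borel_measurable PredE"
  shows "(\<integral>\<^sup>+w. f w \<partial>kern t \<omega>) = (if 0 < mass t \<omega> \<and> mass t \<omega> < \<infinity>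
    then inverse (mass t \<omega>) * (\<integral>\<^sup>+z. weight z * indicator (slab t) z * f (emb \<omega> z) \<partial>N \<omega>) else 0)"
proof -
  note [measurable_cong] = sets_N[OF \<omega>]
  note [measurable] = measurable_emb[OF \<omega>] f
  show ?thesis
    by (simp add: kern_def nn_integral_scale_measure nn_integral_distr nn_integral_density)
qed

lemma subprob_space_kern:
  assumes \<omega>: "\<omega> \<in> space M"
  shows "subprob_space (kern t \<omega>)"
proof (rule subprob_spaceI)
  have "emeasure (kern t \<omega>) (space (kern t \<omega>)) = (\<integral>\<^sup>+w. 1 \<partial>kern t \<omega>)"
    by simp
  also have "\<dots> \<le> 1"
    by (subst nn_integral_kern[OF \<omega>])
       (auto simp: ennreal_mult_inverse mult.commute[of "inverse _"] simp flip: mass_def)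
  finally show "emeasure (kern t \<omega>) (space (kern t \<omega>)) \<le> 1" .
  show "space (kern t \<omega>) \<noteq> {}"
    using \<omega> sets_eq_imp_space_eq[OF sets_kern, of t \<omega>] by (auto simp: space_Pred)
qed

text \<open>On a generating rectangle the sample point enters only through the factor
  \<open>indicator A \<omega>\<close> and the noise itself, which is the shape treated by
  \<open>predictable_history_integral\<close>.\<close>

lemma gen_history_integral:
  assumes "0 \<le> a" "a < b" "B \<in> sets borel" "A \<in> sets (F a)" "\<omega> \<in> space M"
  shows "(\<integral>\<^sup>+z. weight z * indicator (slab t) z * indicator ({a<..b} \<times> B \<times> A) (emb \<omega> z) \<partial>N \<omega>)
    = indicator A \<omega> * (\<integral>\<^sup>+z. weight z * indicator (({a<..b} \<times> B) \<inter> {..<t} \<times> UNIV) z \<partial>N \<omega>)"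
proof -
  have "weight z * indicator (slab t) z * indicator ({a<..b} \<times> B \<times> A) (emb \<omega> z)
    = indicator A \<omega> * (weight z * indicator (({a<..b} \<times> B) \<inter> {..<t} \<times> UNIV) z)" for z
    using \<open>0 \<le> a\<close> by (cases z) (auto simp: emb_def split: split_indicator)
  moreover have "(\<lambda>z. weight z * indicator (({a<..b} \<times> B) \<inter> {..<t} \<times> UNIV) z) \<in> borel_measurable (N \<omega>)"
  proof -
    note [measurable_cong] = sets_N[OF assms(5)]
    have [measurable]: "({a<..b} \<times> B) \<inter> {..<t} \<times> UNIV \<in> sets E"
      using assms(1,3) by (subst Times_Int_Times) (intro Times_in_sets_E, auto)
    show ?thesis by measurable
  qed
  ultimately show ?thesis by (simp add: nn_integral_cmult)
qed

text \<open>Measurability into the space of subprobabilities needs testing only on an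
  intersection-stable generator and on the whole space. Rectangles reduce to integrals over the
  past, and the whole space has mass 1 or 0 according to a predictable condition on
  \<open>mass t \<omega>\<close>.\<close>

lemma kern_measurable: "(\<lambda>(t, x, \<omega>). kern t \<omega>) \<in> measurable (Pred S) (subprob_algebra PredE)"
proof (rule measurable_subprob_algebra_generated[OF sets_Pred Int_stable_gen gen_Pow])
  fix w assume "w \<in> space (Pred S)"
  then show "subprob_space (case w of (t, x, \<omega>) \<Rightarrow> kern t \<omega>)" "sets (case w of (t, x, \<omega>) \<Rightarrow> kern t \<omega>) = sets PredE"
    by (auto simp: space_Pred sets_kern subprob_space_kern)
next
  have em: "emeasure (kern t \<omega>) A = (if 0 < mass t \<omega> \<and> mass t \<omega> < \<infinity>
      then inverse (mass t \<omega>) * (\<integral>\<^sup>+z. weight z * indicator (slab t) z * indicator A (emb \<omega> z) \<partial>N \<omega>) else 0)"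
    if "\<omega> \<in> space M" "A \<in> sets PredE" for t \<omega> A
    using nn_integral_kern[OF that(1), of "indicator A" t] that(2) sets_kern by simp
  have mass_meas: "(\<lambda>w. mass (fst w) (snd (snd w))) \<in> borel_measurable (Pred S)"
    using mass_predictable[of S] by (simp add: case_prod_beta')
  {
    fix A :: "(real \<times> ('d \<times> 'd) \<times> 'w) set" assume A: "A \<in> gen borel"
    then obtain a b B H where ab: "0 \<le> a" "a < b" "B \<in> sets borel" "H \<in> sets (F a)" and A_eq: "A = {a<..b} \<times> B \<times> H"
      unfolding gen_def by blast
    have "(\<lambda>(t, x, \<omega>). indicator H \<omega> * (\<integral>\<^sup>+z. weight z * indicator (({a<..b} \<times> B) \<inter> {..<t} \<times> UNIV) z \<partial>N \<omega>))
      \<in> borel_measurable (Pred S)"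
      using ab by (intro predictable_history_integral[where a=a]) (auto intro!: Times_in_sets_E)
    then have [measurable]: "(\<lambda>w. indicator H (snd (snd w)) * (\<integral>\<^sup>+z. weight z *
      indicator (({a<..b} \<times> B) \<inter> {..<fst w} \<times> UNIV) z \<partial>N (snd (snd w)))) \<in> borel_measurable (Pred S)"
      by (simp add: case_prod_beta')
    note [measurable] = mass_meas
    have "(\<lambda>w. if 0 < mass (fst w) (snd (snd w)) \<and> mass (fst w) (snd (snd w)) < \<infinity> then inverse (mass (fst w) (snd (snd w))) *
      (indicator H (snd (snd w)) * (\<integral>\<^sup>+z. weight z *
        indicator (({a<..b} \<times> B) \<inter> {..<fst w} \<times> UNIV) z \<partial>N (snd (snd w)))) else 0) \<in> borel_measurable (Pred S)"
      by measurable
    also have "?this \<longleftrightarrow> (\<lambda>w. emeasure (case w of (t, x, \<omega>) \<Rightarrow> kern t \<omega>) A) \<in> borel_measurable (Pred S)"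
    proof (rule measurable_cong)
      fix w assume "w \<in> space (Pred S)"
      then obtain t x \<omega> where w: "w = (t, x, \<omega>)" "\<omega> \<in> space M"
        by (auto simp: space_Pred)
      have "A \<in> sets PredE"
        using A unfolding sets_Pred by (rule sigma_sets.Basic)
      then show "(if 0 < mass (fst w) (snd (snd w)) \<and> mass (fst w) (snd (snd w)) < \<infinity> then inverse (mass (fst w) (snd (snd w))) *
        (indicator H (snd (snd w)) * (\<integral>\<^sup>+z. weight z *
          indicator (({a<..b} \<times> B) \<inter> {..<fst w} \<times> UNIV) z \<partial>N (snd (snd w)))) else 0)
        = emeasure (case w of (t, x, \<omega>) \<Rightarrow> kern t \<omega>) A"
        using gen_history_integral[OF ab w(2), of t] em[OF w(2), of A t] by (simp add: w A_eq)
    qed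
    finally show "(\<lambda>w. emeasure (case w of (t, x, \<omega>) \<Rightarrow> kern t \<omega>) A) \<in> borel_measurable (Pred S)" .
  }
  \<comment> \<open>The whole space has unbounded time and is not a generator, so it is tested
    separately.\<close>
  have "(\<lambda>w. if 0 < mass (fst w) (snd (snd w)) \<and> mass (fst w) (snd (snd w)) < \<infinity> then 1 else 0 :: ennreal)
    \<in> borel_measurable (Pred S)"
    using mass_meas by measurable
  also have "?this \<longleftrightarrow> (\<lambda>w. emeasure (case w of (t, x, \<omega>) \<Rightarrow> kern t \<omega>) ({0<..} \<times> space borel \<times> space M))
    \<in> borel_measurable (Pred S)"
  proof (rule measurable_cong)
    fix w assume "w \<in> space (Pred S)"
    then obtain t x \<omega> where w: "w = (t, x, \<omega>)" "\<omega> \<in> space M"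
      by (auto simp: space_Pred)
    have top: "{0<..} \<times> space borel \<times> space M \<in> sets PredE"
      using sets.top[of PredE] by (simp only: space_Pred)
    have "(\<integral>\<^sup>+z. weight z * indicator (slab t) z * indicator ({0<..} \<times> space borel \<times> space M) (emb \<omega> z) \<partial>N \<omega>)
      = mass t \<omega>"
      unfolding mass_def using w by (intro nn_integral_cong) (auto simp: emb_def)
    then show "(if 0 < mass (fst w) (snd (snd w)) \<and> mass (fst w) (snd (snd w)) < \<infinity> then 1 else 0) =
        emeasure (case w of (t, x, \<omega>) \<Rightarrow> kern t \<omega>) ({0<..} \<times> space borel \<times> space M)"
      using em[OF w(2) top, of t] by (simp add: w ennreal_mult_inverse mult.commute[of "inverse _"])
  qed
  finally show "(\<lambda>w. emeasure (case w of (t, x, \<omega>) \<Rightarrow> kern t \<omega>) ({0<..} \<times> space borel \<times> space M))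
    \<in> borel_measurable (Pred S)" .
qed

lemma weight_cancel:
  assumes "\<omega> \<in> space M" "z \<in> space E"
  shows "weight z * indicator (slab t) z * (f (emb \<omega> z) / weight (fst (emb \<omega> z), fst (snd (emb \<omega> z))))
    = f (emb \<omega> z) * indicator (slab t) z"
proof (cases "z \<in> slab t")
  case True
  then have "(fst (emb \<omega> z), fst (snd (emb \<omega> z))) = z"
    by (auto simp: emb_def)
  then show ?thesis
    using True weight_pos[OF assms(2)] weight_finite[OF assms(2)]
    by (simp add: ennreal_times_divide mult_divide_eq_ennreal less_top mult.commute[of "weight z"])
qed simp

text \<open>Undoes both the normalisation and the weight, and so recovers an integral against the
  noise itself.\<close>

lemma mass_times_nn_integral_kern:
  assumes \<omega>: "\<omega> \<in> space M" and f: "f \<in> borel_measurable PredE" and fin: "mass t \<omega> < \<infinity>"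
  shows "mass t \<omega> * (\<integral>\<^sup>+w. f w / weight (fst w, fst (snd w)) \<partial>kern t \<omega>)
    = (\<integral>\<^sup>+z. f (emb \<omega> z) * indicator (slab t) z \<partial>N \<omega>)"
proof -
  note [measurable_cong] = sets_N[OF \<omega>]
  note [measurable] = measurable_emb[OF \<omega>] f measurable_compose[OF measurable_point_Pred weight_measurable]
  have eq: "(\<integral>\<^sup>+z. weight z * indicator (slab t) z * (f (emb \<omega> z) / weight (fst (emb \<omega> z), fst (snd (emb \<omega> z)))) \<partial>N \<omega>)
     = (\<integral>\<^sup>+z. f (emb \<omega> z) * indicator (slab t) z \<partial>N \<omega>)"
    using \<omega> by (intro nn_integral_cong weight_cancel) (auto simp: space_N)
  have kern: "(\<integral>\<^sup>+w. f w / weight (fst w, fst (snd w)) \<partial>kern t \<omega>) = (if 0 < mass t \<omega> \<and> mass t \<omega> < \<infinity>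
    then inverse (mass t \<omega>) * (\<integral>\<^sup>+z. f (emb \<omega> z) * indicator (slab t) z \<partial>N \<omega>) else 0)"
    unfolding eq[symmetric] by (rule nn_integral_kern[OF \<omega>]) measurable
  show ?thesis
  proof (cases "mass t \<omega> = 0")
    case False
    then have "mass t \<omega> * inverse (mass t \<omega>) = 1"
      using fin by (intro ennreal_mult_inverse) (auto simp: zero_less_iff_neq_zero)
    then show ?thesis
      using False fin by (simp add: kern zero_less_iff_neq_zero flip: mult.assoc)
  next
    \<comment> \<open>Here the kernel is null, so the left side vanishes. The right side does too:
      the weight is strictly positive, so zero weighted mass means that the noise does not charge
      the slab.\<close>
    case True
    then have "AE z in N \<omega>. weight z * indicator (slab t) z = 0"
      unfolding mass_def by (subst (asm) nn_integral_0_iff_AE) auto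
    then have "AE z in N \<omega>. z \<notin> slab t"
      using AE_space
    proof eventually_elim
      case (elim z)
      then show ?case using weight_pos[of z] by (auto simp: space_N[OF \<omega>])
    qed
    then have "AE z in N \<omega>. f (emb \<omega> z) * indicator (slab t) z = 0"
      by eventually_elim simp
    then have "(\<integral>\<^sup>+z. f (emb \<omega> z) * indicator (slab t) z \<partial>N \<omega>) = 0"
      by (subst nn_integral_0_iff_AE) measurable
    then show ?thesis by (simp add: True)
  qed
qed

text \<open>The integrand may depend on the evaluation point (t, x, \<omega>), as the convolution
  with the kernel requires. Integration of a jointly measurable function against a measurable kernel
  allows this. The value 0 on infinite mass keeps the result predictable at every sample
  point.\<close>

lemma predictable_nn_integral:
  assumes f: "f \<in> borel_measurable (Pred S \<Otimes>\<^sub>M PredE)"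
  shows "(\<lambda>(t, x, \<omega>). if mass t \<omega> < \<infinity> then \<integral>\<^sup>+z. f ((t, x, \<omega>), emb \<omega> z) * indicator (slab t) z \<partial>N \<omega> else 0)
    \<in> borel_measurable (Pred S)"
proof -
  have [measurable]: "(\<lambda>w. mass (fst w) (snd (snd w))) \<in> borel_measurable (Pred S)"
    using mass_predictable[of S] by (simp add: case_prod_beta')
  note [measurable] = f measurable_compose[OF measurable_point_Pred weight_measurable]
  have "(\<lambda>w. integral\<^sup>N ((\<lambda>(t, x, \<omega>). kern t \<omega>) w) (\<lambda>v. f (w, v) / weight (fst v, fst (snd v))))
    \<in> borel_measurable (Pred S)"
    by (rule nn_integral_measurable_subprob_algebra2[OF _ kern_measurable]) measurable
  then have "(\<lambda>w. if mass (fst w) (snd (snd w)) < \<infinity> then mass (fst w) (snd (snd w)) *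
      integral\<^sup>N ((\<lambda>(t, x, \<omega>). kern t \<omega>) w) (\<lambda>v. f (w, v) / weight (fst v, fst (snd v))) else 0)
        \<in> borel_measurable (Pred S)"
    by measurable
  also have "?this \<longleftrightarrow> ?thesis"
  proof (rule measurable_cong)
    fix w assume w: "w \<in> space (Pred S)"
    then obtain t x \<omega> where w_eq: "w = (t, x, \<omega>)" "\<omega> \<in> space M"
      by (auto simp: space_Pred)
    have "(\<lambda>v. f (w, v)) \<in> borel_measurable PredE"
      using w by measurable
    from mass_times_nn_integral_kern[OF w_eq(2) this, of t]
    show "(if mass (fst w) (snd (snd w)) < \<infinity> then mass (fst w) (snd (snd w)) *
      integral\<^sup>N ((\<lambda>(t, x, \<omega>). kern t \<omega>) w) (\<lambda>v. f (w, v) / weight (fst v, fst (snd v))) else 0) =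
      (\<lambda>(t, x, \<omega>). if mass t \<omega> < \<infinity> then \<integral>\<^sup>+z. f ((t, x, \<omega>), emb \<omega> z) * indicator (slab t) z \<partial>N \<omega> else 0) w"
      by (auto simp: w_eq)
  qed
  finally show ?thesis .
qed

lemma kern_measurable_M:
  assumes "0 < t"
  shows "kern t \<in> measurable M (subprob_algebra PredE)"
  using measurable_compose[OF measurable_section_Pred[OF assms, of undefined borel] kern_measurable]
  by simp

lemma mass_measurable_M:
  assumes "0 < t"
  shows "mass t \<in> borel_measurable M"
  using measurable_compose[OF measurable_section_Pred[OF assms, of undefined borel] mass_predictable]
  by simp

section \<open>The mean formula for predictable integrands\<close>

text \<open>Two measures on the predictable space are compared: \<open>Q1\<close> integrates over
  the weighted noise and then over the sample points, and \<open>Q2\<close> has the intensity in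
  place of the noise. The weight makes them finite, as the uniqueness theorem for measures requires;
  it is removed by integrating \<open>X / weight\<close>.\<close>

theorem predictable_mean:
  assumes X: "X \<in> borel_measurable PredE" and t: "0 < t"
  shows "(\<integral>\<^sup>+\<omega>. (\<integral>\<^sup>+z. X (emb \<omega> z) * indicator (slab t) z \<partial>N \<omega>) \<partial>M)
    = (\<integral>\<^sup>+z. (\<integral>\<^sup>+\<omega>. X (emb \<omega> z) \<partial>M) * indicator (slab t) z \<partial>E)"
proof -
  define w where "w z = weight z * indicator (slab t) z" for z
  have [measurable]: "w \<in> borel_measurable E" unfolding w_def by measurable
  note [measurable] = kern_measurable_M[OF t] mass_measurable_M[OF t] measurable_emb_pair
  \<comment> \<open>The density \<open>mass t\<close> reverses the normalisation in
    \<open>kern\<close>, almost surely.\<close>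
  define Q1 where "Q1 = density M (mass t) \<bind> kern t"
  define Q2 where "Q2 = distr (density E w \<Otimes>\<^sub>M M) PredE (\<lambda>(z, \<omega>). emb \<omega> z)"
  have kern_d: "kern t \<in> measurable (density M (mass t)) (subprob_algebra PredE)"
    by simp
  have sets1: "sets Q1 = sets PredE"
    unfolding Q1_def using not_empty by (intro sets_bind[OF sets_kern]) auto
  have sets2: "sets Q2 = sets PredE"
    unfolding Q2_def by simp
  have Q1: "(\<integral>\<^sup>+v. f v \<partial>Q1) = (\<integral>\<^sup>+\<omega>. mass t \<omega> * (\<integral>\<^sup>+v. f v \<partial>kern t \<omega>) \<partial>M)" if [measurable]: "f
    \<in> borel_measurable PredE" for f
  proof -
    have [measurable]: "(\<lambda>\<omega>. \<integral>\<^sup>+v. f v \<partial>kern t \<omega>) \<in> borel_measurable M"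
      by (rule measurable_compose[OF kern_measurable_M[OF t] nn_integral_measurable_subprob_algebra]) fact
    show ?thesis
      unfolding Q1_def by (subst nn_integral_bind[OF that kern_d]) (simp add: nn_integral_density)
  qed
  have Q2: "(\<integral>\<^sup>+v. f v \<partial>Q2) = (\<integral>\<^sup>+z. w z * (\<integral>\<^sup>+\<omega>. f (emb \<omega> z) \<partial>M) \<partial>E)" if [measurable]: "f \<in> borel_measurable PredE"
    for f
  proof -
    have [measurable]: "(\<lambda>p. f (emb (snd p) (fst p))) \<in> borel_measurable (E \<Otimes>\<^sub>M M)"
      using measurable_compose[OF measurable_emb_pair that] by (simp add: case_prod_beta')
    have "(\<integral>\<^sup>+v. f v \<partial>Q2) = (\<integral>\<^sup>+p. f (emb (snd p) (fst p)) \<partial>(density E w \<Otimes>\<^sub>M M))"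
      unfolding Q2_def by (subst nn_integral_distr) (simp_all add: case_prod_beta')
    also have "\<dots> = (\<integral>\<^sup>+z. \<integral>\<^sup>+\<omega>. f (emb \<omega> z) \<partial>M \<partial>density E w)"
      by (subst nn_integral_fst[symmetric]) simp_all
    also have "\<dots> = (\<integral>\<^sup>+z. w z * (\<integral>\<^sup>+\<omega>. f (emb \<omega> z) \<partial>M) \<partial>E)"
      by (subst nn_integral_density) (simp_all add: borel_measurable_nn_integral)
    finally show ?thesis .
  qed
  have good: "AE \<omega> in M. mass t \<omega> < \<infinity>"
    using AE_mass_finite by eventually_elim simp
  have gen_eq: "emeasure Q1 Z = emeasure Q2 Z" if Z: "Z \<in> gen borel" for Z
  proof -
    from Z obtain a b B A where ab: "0 \<le> a" "a < b" "B \<in> sets borel" "A \<in> sets (F a)" and Z_eq: "Z = {a<..b} \<times> B \<times> A"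
      unfolding gen_def by blast
    have [measurable]: "Z \<in> sets PredE"
      unfolding Z_eq using ab by (rule gen_in_Pred)
    have A: "A \<in> sigma_sets (space M) (history ({0..a} \<times> UNIV))"
      using ab(4) by (simp add: sets_F)
    have [measurable]: "A \<in> events" using ab(4) sets_F_subset by blast
    define R where "R = ({a<..b} \<times> B) \<inter> {..<t} \<times> UNIV"
    have R: "R \<in> sets E"
      unfolding R_def using ab by (subst Times_Int_Times) (intro Times_in_sets_E, auto)
    have "emeasure Q1 Z = (\<integral>\<^sup>+\<omega>. mass t \<omega> * (\<integral>\<^sup>+v. indicator Z v \<partial>kern t \<omega>) \<partial>M)"
      using sets1 by (subst Q1[symmetric]) simp_all
    also have "\<dots> = (\<integral>\<^sup>+\<omega>. indicator A \<omega> * (\<integral>\<^sup>+z. weight z * indicator R z \<partial>N \<omega>) \<partial>M)"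
    proof (intro nn_integral_cong_AE)
      show "AE \<omega> in M. mass t \<omega> * (\<integral>\<^sup>+v. indicator Z v \<partial>kern t \<omega>) = indicator A \<omega> * (\<integral>\<^sup>+z. weight z *
        indicator R z \<partial>N \<omega>)"
        using good AE_space
      proof eventually_elim
        case (elim \<omega>)
        \<comment> \<open>For zero mass this forces the right side to vanish, where no division by
          the mass is possible.\<close>
        have le: "indicator A \<omega> * (\<integral>\<^sup>+z. weight z * indicator R z \<partial>N \<omega>) \<le> mass t \<omega>"
          unfolding gen_history_integral[OF ab elim(2), of t, folded R_def, symmetric] mass_def
          by (intro nn_integral_mono) (auto split: split_indicator)
        show ?case
        proof (cases "mass t \<omega> = 0")
          case True
          with le show ?thesis by simp
        next
          case False
          then have "mass t \<omega> * inverse (mass t \<omega>) = 1"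
            using elim by (intro ennreal_mult_inverse) (auto simp: zero_less_iff_neq_zero)
          then show ?thesis
            using False elim gen_history_integral[OF ab elim(2), of t, folded R_def]
            by (subst nn_integral_kern[OF elim(2) borel_measurable_indicator[OF \<open>Z \<in> sets PredE\<close>]])
              (auto simp: Z_eq zero_less_iff_neq_zero simp flip: mult.assoc)
        qed
      qed
    qed
    \<comment> \<open>The event \<open>A\<close> is known at time \<open>a\<close>, while
      \<open>R\<close> lies strictly after \<open>a\<close>: past and future are
      independent.\<close>
    also have "\<dots> = emeasure M A * (\<integral>\<^sup>+z. weight z * indicator R z \<partial>E)"
    proof (rule history_nn_integral_mean_N[OF _ R _ A])
      show "{0..a} \<times> UNIV \<in> sets E"
        by (rule Times_in_sets_E) auto
      show "{0..a} \<times> UNIV \<inter> R = {}"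
        unfolding R_def by auto
    qed simp
    also have "\<dots> = (\<integral>\<^sup>+z. w z * (\<integral>\<^sup>+\<omega>. indicator Z (emb \<omega> z) \<partial>M) \<partial>E)"
    proof -
      have "w z * (\<integral>\<^sup>+\<omega>. indicator Z (emb \<omega> z) \<partial>M) = emeasure M A * (weight z * indicator R z)" for z
      proof (cases "z \<in> slab t")
        case True
        then have "indicator Z (emb \<omega> z) = indicator A \<omega> * (indicator R z :: ennreal)" for \<omega>
          unfolding Z_eq R_def by (cases z) (auto simp: emb_def split: split_indicator)
        then have "(\<integral>\<^sup>+\<omega>. indicator Z (emb \<omega> z) \<partial>M) = emeasure M A * indicator R z"
          by (simp add: nn_integral_multc)
        then show ?thesis using True by (simp add: w_def ac_simps)
      next
        case False
        then have "z \<notin> R" using ab unfolding R_def by auto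
        with False show ?thesis by (simp add: w_def)
      qed
      then show ?thesis
        using R by (simp add: nn_integral_cmult)
    qed
    also have "\<dots> = emeasure Q2 Z"
      using sets2 by (subst Q2[symmetric]) simp_all
    finally show ?thesis .
  qed
  have "Q1 = Q2"
  proof (rule measure_eqI_generator_eq[OF Int_stable_gen gen_Pow gen_eq])
    show "sets Q1 = sigma_sets ({0<..} \<times> space borel \<times> space M) (gen borel)"
      "sets Q2 = sigma_sets ({0<..} \<times> space borel \<times> space M) (gen borel)"
      using sets1 sets2 by (simp_all only: sets_Pred)
    let ?A = "\<lambda>n::nat. {0<..real n + 1} \<times> (UNIV :: ('d \<times> 'd) set) \<times> space M"
    have "?A n \<in> gen borel" for n
      unfolding gen_def using sets.top[of "F 0"]
      by (intro CollectI exI[of _ "0::real"] exI[of _ "real n + 1"] exI[of _ UNIV] exI[of _ "space M"])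
         (simp add: space_F)
    then show "range ?A \<subseteq> gen borel"
      by blast
    have "\<exists>n::nat. r \<le> real n + 1" for r
      using real_arch_simple[of r] by (meson add_increasing2 zero_le_one)
    then show "(\<Union>n. ?A n) = {0<..} \<times> space borel \<times> space M"
      by auto
    \<comment> \<open>The exhausting sets are generators, so finiteness can be read off from
      \<open>Q2\<close>, where the integral of the weight is a bound.\<close>
    show "emeasure Q1 (?A n) \<noteq> \<infinity>" for n
    proof -
      have A_n: "?A n \<in> gen borel"
        using \<open>range ?A \<subseteq> gen borel\<close> by blast
      then have [measurable]: "?A n \<in> sets PredE"
        unfolding sets_Pred by (rule sigma_sets.Basic)
      have "emeasure Q1 (?A n) = emeasure Q2 (?A n)"
        using A_n by (rule gen_eq)
      also have "\<dots> = (\<integral>\<^sup>+z. w z * (\<integral>\<^sup>+\<omega>. indicator (?A n) (emb \<omega> z) \<partial>M) \<partial>E)"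
        using sets2 by (subst Q2[symmetric]) simp_all
      also have "\<dots> \<le> (\<integral>\<^sup>+z. weight z \<partial>E)"
      proof (rule nn_integral_mono)
        fix z
        have "(\<integral>\<^sup>+\<omega>. indicator (?A n) (emb \<omega> z) \<partial>M) \<le> (\<integral>\<^sup>+\<omega>. 1 \<partial>M)"
          by (intro nn_integral_mono) (auto split: split_indicator)
        then have "(\<integral>\<^sup>+\<omega>. indicator (?A n) (emb \<omega> z) \<partial>M) \<le> 1"
          by (simp add: emeasure_space_1)
        then have "w z * (\<integral>\<^sup>+\<omega>. indicator (?A n) (emb \<omega> z) \<partial>M) \<le> w z * 1"
          by (rule mult_left_mono) simp
        also have "\<dots> \<le> weight z"
          by (simp add: w_def split: split_indicator)
        finally show "w z * (\<integral>\<^sup>+\<omega>. indicator (?A n) (emb \<omega> z) \<partial>M) \<le> weight z" .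
      qed
      finally show ?thesis using weight_integral by (auto simp: top_unique)
    qed
  qed
  note [measurable] = X measurable_compose[OF measurable_point_Pred weight_measurable]
  have Y[measurable]: "(\<lambda>v. X v / weight (fst v, fst (snd v))) \<in> borel_measurable PredE"
    by measurable
  have "(\<integral>\<^sup>+\<omega>. (\<integral>\<^sup>+z. X (emb \<omega> z) * indicator (slab t) z \<partial>N \<omega>) \<partial>M)
    = (\<integral>\<^sup>+\<omega>. mass t \<omega> * (\<integral>\<^sup>+v. X v / weight (fst v, fst (snd v)) \<partial>kern t \<omega>) \<partial>M)"
  proof (intro nn_integral_cong_AE)
    show "AE \<omega> in M. (\<integral>\<^sup>+z. X (emb \<omega> z) * indicator (slab t) z \<partial>N \<omega>) = mass t \<omega> *
      (\<integral>\<^sup>+v. X v / weight (fst v, fst (snd v)) \<partial>kern t \<omega>)"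
      using good AE_space by eventually_elim (simp add: mass_times_nn_integral_kern X)
  qed
  also have "\<dots> = (\<integral>\<^sup>+z. w z * (\<integral>\<^sup>+\<omega>. X (emb \<omega> z) / weight (fst (emb \<omega> z), fst (snd (emb \<omega> z))) \<partial>M) \<partial>E)"
    unfolding Q1[OF Y, symmetric] \<open>Q1 = Q2\<close> by (rule Q2[OF Y])
  also have "\<dots> = (\<integral>\<^sup>+z. (\<integral>\<^sup>+\<omega>. X (emb \<omega> z) \<partial>M) * indicator (slab t) z \<partial>E)"
  proof (rule nn_integral_cong)
    fix z assume z: "z \<in> space E"
    have [measurable]: "(\<lambda>\<omega>. X (emb \<omega> z)) \<in> borel_measurable M"
      using measurable_compose[OF measurable_compose[OF measurable_Pair1'[OF z] measurable_emb_pair] X] by simp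
    have [measurable]: "(\<lambda>\<omega>. X (emb \<omega> z) / weight (fst (emb \<omega> z), fst (snd (emb \<omega> z)))) \<in> borel_measurable M"
      using measurable_compose[OF measurable_compose[OF measurable_Pair1'[OF z] measurable_emb_pair] Y] by simp
    have "w z * (\<integral>\<^sup>+\<omega>. X (emb \<omega> z) / weight (fst (emb \<omega> z), fst (snd (emb \<omega> z))) \<partial>M)
      = (\<integral>\<^sup>+\<omega>. w z * (X (emb \<omega> z) / weight (fst (emb \<omega> z), fst (snd (emb \<omega> z)))) \<partial>M)"
      by (simp add: nn_integral_cmult)
    also have "\<dots> = (\<integral>\<^sup>+\<omega>. X (emb \<omega> z) * indicator (slab t) z \<partial>M)"
      unfolding w_def using z by (intro nn_integral_cong weight_cancel) auto
    also have "\<dots> = (\<integral>\<^sup>+\<omega>. X (emb \<omega> z) \<partial>M) * indicator (slab t) z"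
      by (simp add: nn_integral_multc)
    finally show "w z * (\<integral>\<^sup>+\<omega>. X (emb \<omega> z) / weight (fst (emb \<omega> z), fst (snd (emb \<omega> z))) \<partial>M)
      = (\<integral>\<^sup>+\<omega>. X (emb \<omega> z) \<partial>M) * indicator (slab t) z" .
  qed
  finally show ?thesis .
qed

text \<open>A finite mean gives almost sure finiteness. Measurability in \<omega> is available for
  the version that is 0 on infinite mass, so the argument passes through that version.\<close>

lemma AE_nn_integral_finite:
  assumes X: "X \<in> borel_measurable PredE" and t: "0 < t"
    and fin: "(\<integral>\<^sup>+z. (\<integral>\<^sup>+\<omega>. X (emb \<omega> z) \<partial>M) * indicator (slab t) z \<partial>E) < \<infinity>"
  shows "AE \<omega> in M. (\<integral>\<^sup>+z. X (emb \<omega> z) * indicator (slab t) z \<partial>N \<omega>) < \<infinity>"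
proof -
  let ?I = "\<lambda>\<omega>. \<integral>\<^sup>+z. X (emb \<omega> z) * indicator (slab t) z \<partial>N \<omega>"
  have good: "AE \<omega> in M. mass t \<omega> < \<infinity>"
    using AE_mass_finite by eventually_elim simp
  have "(\<lambda>w. X (snd w)) \<in> borel_measurable (Pred (borel :: 'd measure) \<Otimes>\<^sub>M PredE)"
    using X by measurable
  from measurable_compose[OF measurable_section_Pred[OF t, of 0] predictable_nn_integral[OF this]]
  have "(\<lambda>\<omega>. if mass t \<omega> < \<infinity> then ?I \<omega> else 0) \<in> borel_measurable M"
    by (simp only: prod.case snd_conv space_borel UNIV_I simp_thms)
  moreover have "(\<integral>\<^sup>+\<omega>. (if mass t \<omega> < \<infinity> then ?I \<omega> else 0) \<partial>M) = (\<integral>\<^sup>+\<omega>. ?I \<omega> \<partial>M)"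
  proof (rule nn_integral_cong_AE)
    show "AE \<omega> in M. (if mass t \<omega> < \<infinity> then ?I \<omega> else 0) = ?I \<omega>"
      using good by eventually_elim simp
  qed
  ultimately have "AE \<omega> in M. (if mass t \<omega> < \<infinity> then ?I \<omega> else 0) \<noteq> \<infinity>"
    using fin predictable_mean[OF X t] by (intro nn_integral_PInf_AE) auto
  with good show ?thesis
    by eventually_elim (simp add: less_top)
qed

end

section \<open>The kernel\<close>

text \<open>The Fourier transform is evaluated at the origin, where
  \<open>0 powr \<alpha> = 0\<close>.\<close>

lemma isotropic_stable_density_nn_integral:
  assumes p: "isotropic_stable_density \<alpha> \<nu> p" and s: "0 < s"
  shows "(\<integral>\<^sup>+x. ennreal (p s x) \<partial>lborel) = 1"
proof -
  have int: "integrable lborel (p s)" and nonneg: "\<And>x. 0 \<le> p s x"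
    and "(CLINT x|lborel. iexp (0 \<bullet> x) * complex_of_real (p s x)) = complex_of_real (exp (- s * \<nu> *
      norm (0::'a) powr \<alpha>))"
    using p s unfolding isotropic_stable_density_def by blast+
  then have "complex_of_real (LINT x|lborel. p s x) = complex_of_real 1"
    by simp
  then have "(LINT x|lborel. p s x) = 1"
    by (simp only: of_real_eq_iff)
  then show ?thesis
    using nn_integral_eq_integral[OF int] nonneg by simp
qed

text \<open>For negative \<open>t\<close> the prefactor is negative, but then \<open>g\<close> is
  evaluated at a negative point, where it vanishes, or \<open>s = 0\<close> and the power of
  \<open>s\<close> is 0.\<close>

lemma inverse_subordinator_density_nonneg:
  assumes g: "stable_subordinator_density \<beta> g" and \<beta>: "0 < \<beta>"
  shows "0 \<le> inverse_subordinator_density \<beta> g t s"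
proof (cases "0 \<le> t")
  case True
  then show ?thesis
    using g \<beta> by (simp add: inverse_subordinator_density_def stable_subordinator_density_def)
next
  case False
  then have "t * s powr (- 1 / \<beta>) < 0 \<or> s = 0"
    by (cases "s = 0") (simp_all add: mult_neg_pos)
  then show ?thesis
    using g by (auto simp: inverse_subordinator_density_def stable_subordinator_density_def)
qed

lemma inverse_subordinator_density_neg:
  assumes g: "stable_subordinator_density \<beta> g" and t: "t \<le> 0"
  shows "inverse_subordinator_density \<beta> g t s = 0"
proof (cases "t = 0 \<or> s = 0")
  case False
  then have "t * s powr (- 1 / \<beta>) < 0"
    using t by (simp add: mult_neg_pos)
  then show ?thesis
    using g by (auto simp: inverse_subordinator_density_def stable_subordinator_density_def)
qed (auto simp: inverse_subordinator_density_def)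

(* Substituting r = t s^(-1/\<beta>) turns the integral into the integral of g over the half-line. *)
lemma inverse_subordinator_density_nn_integral:
  assumes g: "stable_subordinator_density \<beta> g" and \<beta>: "0 < \<beta>"
  shows "(\<integral>\<^sup>+s. ennreal (inverse_subordinator_density \<beta> g t s) * indicator {0<..} s \<partial>lborel) \<le> 1"
proof (cases "0 < t")
  case False
  then show ?thesis by (simp add: inverse_subordinator_density_neg[OF g])
next
  case True
  define h where "h s = t * s powr (- 1 / \<beta>)" for s
  define h' where "h' s = t * ((- 1 / \<beta>) * s powr (- 1 / \<beta> - 1))" for s
  have int: "integrable lborel g" and g_nonneg: "\<And>x. 0 \<le> g x" and total: "(LINT x|lborel. g x) = 1"
  proof -
    \<comment> \<open>The Laplace transform at \<open>l = 0\<close> is the total mass of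
      \<open>g\<close>.\<close>
    have "\<forall>l\<ge>0. (LINT x|lborel. exp (- l * x) * g x) = exp (- (l powr \<beta>))"
      using g by (simp add: stable_subordinator_density_def)
    from this[rule_format, of 0] show "(LINT x|lborel. g x) = 1"
      by simp
  qed (use g in \<open>auto simp: stable_subordinator_density_def\<close>)
  \<comment> \<open>Absolute integrability in the change of variables theorem refers to the
    completed measure.\<close>
  have int': "integrable lebesgue g"
    using int by (intro integrable_completion[THEN iffD2]) auto
  have image: "h ` {0<..} = {0<..}"
  proof (intro equalityI subsetI)
    fix r :: real assume r: "r \<in> {0<..}"
    have "h ((t / r) powr \<beta>) = r"
      using r True \<beta> by (simp add: h_def powr_powr powr_minus_divide)
    then show "r \<in> h ` {0<..}"
      using r True by (intro image_eqI[of _ _ "(t / r) powr \<beta>"]) auto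
  qed (use True in \<open>auto simp: h_def\<close>)
  have abs: "g absolutely_integrable_on {0<..}"
    unfolding set_integrable_def using int' by (intro integrable_mult_indicator) auto
  have "(\<lambda>s. \<bar>h' s\<bar> * g (h s)) absolutely_integrable_on {0<..} \<and>
      integral {0<..} (\<lambda>s. \<bar>h' s\<bar> * g (h s)) = integral {0<..} g
    \<longleftrightarrow> g absolutely_integrable_on (h ` {0<..}) \<and> integral (h ` {0<..}) g = integral {0<..} g"
  proof (rule has_absolute_integral_change_of_variables_1')
    show "(h has_real_derivative h' s) (at s within {0<..})" if "s \<in> {0<..}" for s
      using that unfolding h_def h'_def by (auto intro!: derivative_eq_intros)
    show "inj_on h {0<..}"
    proof (rule inj_onI)
      fix a b :: real assume ab: "a \<in> {0<..}" "b \<in> {0<..}" "h a = h b"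
      then have "(a powr (- 1 / \<beta>)) powr (- \<beta>) = (b powr (- 1 / \<beta>)) powr (- \<beta>)"
        using True by (simp add: h_def)
      then show "a = b" using ab \<beta> by (simp add: powr_powr)
    qed
  qed simp
  then have ai: "(\<lambda>s. \<bar>h' s\<bar> * g (h s)) absolutely_integrable_on {0<..}"
    and eq: "integral {0<..} (\<lambda>s. \<bar>h' s\<bar> * g (h s)) = integral {0<..} g"
    using abs image by auto
  have dens: "inverse_subordinator_density \<beta> g t s = \<bar>h' s\<bar> * g (h s)" for s
  proof -
    have "- 1 / \<beta> - 1 = - 1 - 1 / \<beta>" by simp
    then have "\<bar>h' s\<bar> = \<bar>t * (- 1 / \<beta> * s powr (- 1 - 1 / \<beta>))\<bar>"
      unfolding h'_def by (simp only:)
    also have "\<dots> = t / \<beta> * s powr (- 1 - 1 / \<beta>)"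
      using True \<beta> by (simp add: abs_mult)
    finally have "\<bar>h' s\<bar> = t / \<beta> * s powr (- 1 - 1 / \<beta>)" .
    then show ?thesis by (simp add: inverse_subordinator_density_def h_def)
  qed
  have "((\<lambda>s. \<bar>h' s\<bar> * g (h s)) has_integral integral {0<..} g) {0<..}"
    using ai eq absolutely_integrable_on_def has_integral_integral by metis
  then have "(\<integral>\<^sup>+s. ennreal (\<bar>h' s\<bar> * g (h s)) * indicator {0<..} s \<partial>lborel) = ennreal (integral {0<..} g)"
    by (intro nn_integral_has_integral_lebesgue') (auto simp: g_nonneg)
  also have "integral {0<..} g = (LINT x:{0<..}|lebesgue. g x)"
    using abs by (simp add: set_lebesgue_integral_eq_integral)
  also have "\<dots> \<le> (LINT x|lebesgue. g x)"
    unfolding set_lebesgue_integral_def using abs int' g_nonneg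
    by (intro integral_mono) (auto simp: set_integrable_def indicator_def)
  also have "\<dots> = 1"
    using int total by (subst integral_completion) auto
  finally show ?thesis by (simp add: dens ennreal_leI)
qed

text \<open>Without integrability the left side is 0 by convention and the inequality survives. The
  points where the integral defining the fundamental solution diverges thus need no separate
  treatment.\<close>

lemma set_lebesgue_integral_le_nn_integral:
  fixes f :: "'a \<Rightarrow> real"
  assumes "\<And>x. x \<in> A \<Longrightarrow> 0 \<le> f x"
  shows "ennreal (LINT x:A|M. f x) \<le> (\<integral>\<^sup>+x. ennreal (f x) * indicator A x \<partial>M)"
proof (cases "set_integrable M A f")
  case True
  have "(\<integral>\<^sup>+x. ennreal (f x) * indicator A x \<partial>M) = (\<integral>\<^sup>+x. ennreal (indicator A x *\<^sub>R f x) \<partial>M)"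
    by (intro nn_integral_cong) (auto split: split_indicator)
  also have "\<dots> = ennreal (LINT x:A|M. f x)"
    unfolding set_lebesgue_integral_def using True assms
    by (intro nn_integral_eq_integral) (auto simp: set_integrable_def indicator_def)
  finally show ?thesis by simp
next
  case False
  then show ?thesis
    by (simp add: set_lebesgue_integral_def set_integrable_def not_integrable_integral_eq)
qed

lemma fundamental_solution_0: "fundamental_solution \<beta> p g 0 x = 0"
  by (simp add: fundamental_solution_def inverse_subordinator_density_def)

context
  fixes \<alpha> \<beta> \<nu> :: real and p :: "real \<Rightarrow> 'd::euclidean_space \<Rightarrow> real" and g :: "real \<Rightarrow> real"
  assumes p: "isotropic_stable_density \<alpha> \<nu> p" and g: "stable_subordinator_density \<beta> g" and \<beta>: "0 < \<beta>"
begin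

private lemma p_measurable: "(\<lambda>(s, x). indicator {0<..} s * p s x) \<in> borel_measurable (borel \<Otimes>\<^sub>M borel)"
proof -
  have "{0::real<..} \<times> (UNIV :: 'd set) \<in> sets (borel \<Otimes>\<^sub>M borel)"
    by (rule pair_measureI) auto
  then have "(\<lambda>sx. indicator ({0<..} \<times> UNIV) sx *\<^sub>R (\<lambda>(s, x). p s x) sx) \<in> borel_measurable borel"
    using p unfolding isotropic_stable_density_def borel_prod
    by (subst borel_measurable_restrict_space_iff[symmetric]) auto
  moreover have "(\<lambda>sx. indicator ({0<..} \<times> UNIV) sx *\<^sub>R (\<lambda>(s, x). p s x) sx) = (\<lambda>(s, x). indicator {0<..} s * p s x)"
    by (auto simp: fun_eq_iff split: split_indicator)
  ultimately show ?thesis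
    unfolding borel_prod by simp
qed

private lemma f_measurable: "(\<lambda>(t, s). inverse_subordinator_density \<beta> g t s) \<in> borel_measurable (borel \<Otimes>\<^sub>M borel)"
proof -
  have [measurable]: "g \<in> borel_measurable borel"
    using g by (simp add: stable_subordinator_density_def)
  show ?thesis unfolding inverse_subordinator_density_def by measurable
qed

lemma fundamental_solution_measurable:
  "(\<lambda>(t, x). fundamental_solution \<beta> p g t x) \<in> borel_measurable (borel \<Otimes>\<^sub>M borel)"
proof -
  note [measurable] = p_measurable f_measurable
  have "(\<lambda>w. LINT s|lborel. (indicator {0<..} s * p s (snd w)) * inverse_subordinator_density \<beta> g (fst w) s)
    \<in> borel_measurable (borel \<Otimes>\<^sub>M borel)"
    by measurable
  then show ?thesis
    by (simp add: fundamental_solution_def set_lebesgue_integral_def case_prod_beta' mult.assoc)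
qed

lemma fundamental_solution_nonneg: "0 \<le> fundamental_solution \<beta> p g t x"
  unfolding fundamental_solution_def set_lebesgue_integral_def
  using p inverse_subordinator_density_nonneg[OF g \<beta>]
  by (intro integral_nonneg_AE AE_I2) (auto simp: isotropic_stable_density_def indicator_def)

text \<open>By Tonelli: the probability densities \<open>p s\<close> are mixed over \<open>s\<close>
  by a density of mass at most 1.\<close>

lemma fundamental_solution_nn_integral:
  "(\<integral>\<^sup>+x. ennreal (fundamental_solution \<beta> p g t x) \<partial>lborel) \<le> 1"
proof -
  let ?f = "inverse_subordinator_density \<beta> g t"
  note [measurable] = p_measurable f_measurable
  have f_nonneg: "0 \<le> ?f s" for s
    by (rule inverse_subordinator_density_nonneg[OF g \<beta>])
  have p_nonneg: "0 \<le> p s x" if "0 < s" for s x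
    using p that by (simp add: isotropic_stable_density_def)
  have "(\<integral>\<^sup>+x. ennreal (fundamental_solution \<beta> p g t x) \<partial>lborel)
    \<le> (\<integral>\<^sup>+x. \<integral>\<^sup>+s. ennreal (p s x * ?f s) * indicator {0<..} s \<partial>lborel \<partial>lborel)"
    unfolding fundamental_solution_def
    by (intro nn_integral_mono set_lebesgue_integral_le_nn_integral) (auto simp: f_nonneg p_nonneg)
  also have "\<dots> = (\<integral>\<^sup>+x. \<integral>\<^sup>+s. ennreal (indicator {0<..} s * p s x) * ennreal (?f s) \<partial>lborel \<partial>lborel)"
    by (intro nn_integral_cong) (auto simp: f_nonneg p_nonneg ennreal_mult split: split_indicator)
  also have "\<dots> = (\<integral>\<^sup>+s. \<integral>\<^sup>+x. ennreal (indicator {0<..} s * p s x) * ennreal (?f s) \<partial>lborel \<partial>lborel)"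
    by (rule lborel_pair.Fubini') measurable
  also have "\<dots> = (\<integral>\<^sup>+s. (\<integral>\<^sup>+x. ennreal (indicator {0<..} s * p s x) \<partial>lborel) * ennreal (?f s) \<partial>lborel)"
    by (intro nn_integral_cong nn_integral_multc) measurable
  also have "\<dots> = (\<integral>\<^sup>+s. ennreal (?f s) * indicator {0<..} s \<partial>lborel)"
    by (intro nn_integral_cong)
       (auto simp: isotropic_stable_density_nn_integral[OF p] split: split_indicator)
  also have "\<dots> \<le> 1"
    by (rule inverse_subordinator_density_nn_integral[OF g \<beta>])
  finally show ?thesis .
qed

end

section \<open>The Picard map\<close>

locale mild_equation = poisson_noise M \<mu> N
  for M :: "'w measure" and \<mu> :: "'d::euclidean_space measure" and N :: "'w \<Rightarrow> (real \<times> 'd \<times> 'd) measure" +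
  fixes G :: "real \<Rightarrow> 'd \<Rightarrow> real" and \<sigma> :: "real \<Rightarrow> 'd \<Rightarrow> real" and u0 J :: "'d \<Rightarrow> real" and Lip K A :: real
  assumes G_measurable[measurable]: "(\<lambda>(t, x). G t x) \<in> borel_measurable (borel \<Otimes>\<^sub>M borel)"
    and G_nonneg: "0 \<le> G t x" and G_0: "G 0 x = 0"
    and G_nn_integral: "(\<integral>\<^sup>+x. ennreal (G t x) \<partial>lborel) \<le> 1"
    and u0_measurable[measurable]: "u0 \<in> borel_measurable borel" and u0_bound: "\<bar>u0 x\<bar> \<le> A"
    and \<sigma>_measurable: "(\<lambda>(x, h). \<sigma> x h) \<in> borel_measurable borel"
    and J_measurable[measurable]: "J \<in> borel_measurable borel" and J_nonneg: "0 \<le> J h"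
    and Lip: "0 < Lip" and K: "0 < K"
    and \<sigma>_0: "\<sigma> 0 h = 0"
    and \<sigma>_Lipschitz: "\<bar>\<sigma> r h - \<sigma> r' h\<bar> \<le> J h * Lip * \<bar>r - r'\<bar>"
    and J_nn_integral: "(\<integral>\<^sup>+h. ennreal (J h) \<partial>\<mu>) \<le> ennreal K"
begin

lemma \<sigma>_measurable_pair[measurable]: "(\<lambda>(x, h). \<sigma> x h) \<in> borel_measurable (borel \<Otimes>\<^sub>M borel)"
  using \<sigma>_measurable by (simp add: borel_prod)

lemma A_nonneg: "0 \<le> A"
  using u0_bound[of 0] by linarith

lemma G_reflected_nn_integral: "(\<integral>\<^sup>+y. ennreal (G t (x - y)) \<partial>lborel) \<le> 1"
proof -
  have "(\<integral>\<^sup>+y. ennreal (G t y) \<partial>lborel) = (\<integral>\<^sup>+y. ennreal (G t (x - y)) \<partial>lborel)"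
    by (subst lborel_affine[of "-1" x]) (simp_all add: nn_integral_density nn_integral_distr)
  then show ?thesis using G_nn_integral[of t] by simp
qed

definition free :: "real \<Rightarrow> 'd \<Rightarrow> real" where
  "free t x = (LINT y|lborel. G t (x - y) * u0 y)"

lemma free_nn_integral: "(\<integral>\<^sup>+y. ennreal \<bar>G t (x - y) * u0 y\<bar> \<partial>lborel) \<le> ennreal A"
proof -
  have "(\<integral>\<^sup>+y. ennreal \<bar>G t (x - y) * u0 y\<bar> \<partial>lborel) \<le> (\<integral>\<^sup>+y. ennreal A * ennreal (G t (x - y)) \<partial>lborel)"
    using G_nonneg u0_bound A_nonneg
    by (intro nn_integral_mono)
      (auto simp: abs_mult mult.commute mult_right_mono simp flip: ennreal_mult intro!: ennreal_leI)
  also have "\<dots> = ennreal A * (\<integral>\<^sup>+y. ennreal (G t (x - y)) \<partial>lborel)"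
    by (rule nn_integral_cmult) measurable
  also have "\<dots> \<le> ennreal A * 1"
    by (intro mult_left_mono G_reflected_nn_integral) simp
  finally show ?thesis by simp
qed

lemma free_integrable: "integrable lborel (\<lambda>y. G t (x - y) * u0 y)"
  using free_nn_integral[of t x] by (intro integrableI_bounded) (auto simp: le_less_trans[OF _ ennreal_less_top])

lemma free_bound: "\<bar>free t x\<bar> \<le> A"
proof -
  have "ennreal \<bar>free t x\<bar> \<le> ennreal A"
    using integral_norm_bound_ennreal[OF free_integrable[of t x]] free_nn_integral[of t x]
    by (simp add: free_def)
  then show ?thesis using A_nonneg by simp
qed

lemma free_measurable[measurable]: "(\<lambda>(t, x). free t x) \<in> borel_measurable (borel \<Otimes>\<^sub>M borel)"
  unfolding free_def by measurable

definition rate :: real where "rate = 2 * K * Lip"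

lemma rate_pos: "0 < rate"
  using K Lip by (simp add: rate_def)

lemma exp_nn_integral:
  assumes "0 \<le> t"
  shows "(\<integral>\<^sup>+s. ennreal (exp (rate * s)) * indicator {0<..<t} s \<partial>lborel) \<le> ennreal (exp (rate * t) / rate)"
proof -
  have "(\<integral>\<^sup>+s. ennreal (exp (rate * s)) * indicator {0<..<t} s \<partial>lborel) \<le> (\<integral>\<^sup>+s. ennreal (exp (rate * s)) *
    indicator {0..t} s \<partial>lborel)"
    by (intro nn_integral_mono) (auto split: split_indicator)
  also have "\<dots> = ennreal (exp (rate * t) / rate - exp (rate * 0) / rate)"
    using assms rate_pos
    by (intro nn_integral_FTC_Icc)
      (auto intro!: derivative_eq_intros simp: has_real_derivative_iff_has_vector_derivative[symmetric])
  also have "\<dots> \<le> ennreal (exp (rate * t) / rate)"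
    using rate_pos by (intro ennreal_leI) simp
  finally show ?thesis .
qed

(* The factor 1/2 comes from the choice rate = 2 K Lip in the exponential weight. *)
lemma weighted_contraction:
  assumes t: "0 \<le> t" and c: "0 \<le> c"
  shows "(\<integral>\<^sup>+z. ennreal (G (t - fst z) (x - fst (snd z)) * J (snd (snd z)) * Lip * (c * exp (rate * fst z))) *
    indicator (slab t) z \<partial>E)
    \<le> ennreal (c / 2 * exp (rate * t))"
proof -
  interpret mu: sigma_finite_measure \<mu>
    using levy by (simp add: levy_measure_def)
  interpret P: pair_sigma_finite "lborel :: 'd measure" \<mu> ..
  define a where "a s = ennreal (Lip * c) * (ennreal (exp (rate * s)) * indicator {0<..<t} s)" for s
  define b where "b s y = ennreal (G (t - s) (x - y))" for s y
  have [measurable]: "a \<in> borel_measurable borel"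
    unfolding a_def by measurable
  have b[measurable]: "(\<lambda>(s, y). b s y) \<in> borel_measurable (borel \<Otimes>\<^sub>M borel)"
    unfolding b_def by measurable
  have [measurable]: "J \<in> borel_measurable \<mu>"
    by (simp add: measurable_cong_sets[OF sets_mu refl])
  have id[measurable]: "(\<lambda>s. s) \<in> borel_measurable (restrict_space lborel {0::real..})"
    by (rule measurable_restrict_space1) simp
  let ?f = "\<lambda>z. a (fst z) * (b (fst z) (fst (snd z)) * ennreal (J (snd (snd z))))"
  have f_meas: "?f \<in> borel_measurable (restrict_space lborel {0..} \<Otimes>\<^sub>M (lborel \<Otimes>\<^sub>M \<mu>))"
  proof -
    have [measurable]: "(\<lambda>z. fst z) \<in> borel_measurable (restrict_space lborel {0::real..} \<Otimes>\<^sub>M (lborel \<Otimes>\<^sub>M \<mu>))"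
      by (rule measurable_compose[OF measurable_fst id])
    have [measurable]: "(\<lambda>z. b (fst z) (fst (snd z)))
      \<in> borel_measurable (restrict_space lborel {0::real..} \<Otimes>\<^sub>M ((lborel :: 'd measure) \<Otimes>\<^sub>M \<mu>))"
      using b by measurable
    show ?thesis by measurable
  qed
  have "(\<integral>\<^sup>+z. ennreal (G (t - fst z) (x - fst (snd z)) * J (snd (snd z)) * Lip * (c * exp (rate * fst z))) *
    indicator (slab t) z \<partial>E)
    = (\<integral>\<^sup>+z. ?f z \<partial>E)"
    using G_nonneg J_nonneg Lip c
    by (intro nn_integral_cong)
       (auto simp: a_def b_def ennreal_mult ac_simps split: split_indicator)
  also have "\<dots> = (\<integral>\<^sup>+s. (\<integral>\<^sup>+w. a s * (b s (fst w) *
    ennreal (J (snd w))) \<partial>(lborel \<Otimes>\<^sub>M \<mu>)) \<partial>restrict_space lborel {0..})"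
    unfolding noise_intensity_def using P.nn_integral_fst[OF f_meas] by simp
  also have "\<dots> \<le> (\<integral>\<^sup>+s. a s * ennreal K \<partial>restrict_space lborel {0..})"
  proof (rule nn_integral_mono)
    fix s :: real
    have [measurable]: "b s \<in> borel_measurable lborel"
      unfolding b_def by measurable
    have "(\<integral>\<^sup>+w. a s * (b s (fst w) * ennreal (J (snd w))) \<partial>(lborel \<Otimes>\<^sub>M \<mu>))
      = a s * (\<integral>\<^sup>+w. b s (fst w) * ennreal (J (snd w)) \<partial>(lborel \<Otimes>\<^sub>M \<mu>))"
      by (rule nn_integral_cmult) measurable
    also have "(\<integral>\<^sup>+w. b s (fst w) * ennreal (J (snd w)) \<partial>(lborel \<Otimes>\<^sub>M \<mu>)) = (\<integral>\<^sup>+y. \<integral>\<^sup>+h. b s y *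
      ennreal (J h) \<partial>\<mu> \<partial>lborel)"
      by (subst mu.nn_integral_fst[symmetric]) simp_all
    also have "\<dots> = (\<integral>\<^sup>+y. b s y \<partial>lborel) * (\<integral>\<^sup>+h. ennreal (J h) \<partial>\<mu>)"
      by (simp add: nn_integral_cmult nn_integral_multc)
    also have "a s * \<dots> \<le> a s * (1 * ennreal K)"
      unfolding b_def by (intro mult_mono G_reflected_nn_integral J_nn_integral) auto
    finally show "(\<integral>\<^sup>+w. a s * (b s (fst w) * ennreal (J (snd w))) \<partial>(lborel \<Otimes>\<^sub>M \<mu>)) \<le> a s * ennreal K"
      by simp
  qed
  also have "\<dots> = (\<integral>\<^sup>+s. a s * ennreal K * indicator {0..} s \<partial>lborel)"
    by (rule nn_integral_restrict_space) simp
  also have "\<dots> \<le> (\<integral>\<^sup>+s. a s * ennreal K \<partial>lborel)"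
    by (intro nn_integral_mono) (auto split: split_indicator)
  also have "\<dots> = ennreal (Lip * c) * (\<integral>\<^sup>+s. ennreal (exp (rate * s)) * indicator {0<..<t} s \<partial>lborel) * ennreal K"
    unfolding a_def by (simp add: nn_integral_multc nn_integral_cmult)
  also have "\<dots> \<le> ennreal (Lip * c) * ennreal (exp (rate * t) / rate) * ennreal K"
    by (intro mult_right_mono mult_left_mono exp_nn_integral t) auto
  also have "\<dots> = ennreal (Lip * c * (exp (rate * t) / rate) * K)"
    using Lip c K rate_pos by (simp add: ennreal_mult'[symmetric] del: times_divide_eq_right)
  also have "Lip * c * (exp (rate * t) / rate) * K = c / 2 * exp (rate * t)"
    using Lip K by (simp add: rate_def field_simps)
  finally show ?thesis .
qed

abbreviation predictable :: "(real \<Rightarrow> 'd \<Rightarrow> 'w \<Rightarrow> real) \<Rightarrow> bool" where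
  "predictable \<equiv> predictable_field M \<mu> N"

abbreviation L1 :: "('w \<Rightarrow> real) \<Rightarrow> ennreal" where
  "L1 f \<equiv> \<integral>\<^sup>+\<omega>. ennreal \<bar>f \<omega>\<bar> \<partial>M"

lemma predictable_section:
  assumes "predictable u" "0 < t"
  shows "u t x \<in> borel_measurable M"
  using measurable_compose[OF measurable_section_Pred[OF assms(2), of x borel]
    assms(1)[unfolded predictable_field_def]]
  by simp

lemma L1_triangle:
  assumes "u \<in> borel_measurable M" "v \<in> borel_measurable M"
  shows "L1 (\<lambda>\<omega>. u \<omega> + v \<omega>) \<le> L1 u + L1 v"
proof -
  have "L1 (\<lambda>\<omega>. u \<omega> + v \<omega>) \<le> (\<integral>\<^sup>+\<omega>. ennreal \<bar>u \<omega>\<bar> + ennreal \<bar>v \<omega>\<bar> \<partial>M)"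
    by (intro nn_integral_mono) (simp flip: ennreal_plus add: ennreal_leI)
  also have "\<dots> = L1 u + L1 v"
    using assms by (intro nn_integral_add) auto
  finally show ?thesis .
qed

section \<open>The stochastic convolution and a predictable version of the mild map\<close>

definition integrand :: "(real \<Rightarrow> 'd \<Rightarrow> 'w \<Rightarrow> real) \<Rightarrow> real \<Rightarrow> 'd \<Rightarrow> real \<times> ('d \<times> 'd) \<times> 'w \<Rightarrow> real" where
  "integrand u t x = (\<lambda>(s, (y, h), \<omega>). G (t - s) (x - y) * \<sigma> (u s y \<omega>) h)"

lemma components_measurable:
  assumes "predictable u"
  shows "(\<lambda>v. u (fst v) (fst (fst (snd v))) (snd (snd v))) \<in> borel_measurable PredE"
    and "(\<lambda>v. fst (fst (snd v))) \<in> borel_measurable PredE"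
    and "(\<lambda>v. snd (fst (snd v))) \<in> borel_measurable PredE"
proof -
  show "(\<lambda>v. u (fst v) (fst (fst (snd v))) (snd (snd v))) \<in> borel_measurable PredE"
    using measurable_compose[OF measurable_drop_Pred assms[unfolded predictable_field_def]] by simp
  show "(\<lambda>v. fst (fst (snd v))) \<in> borel_measurable PredE" "(\<lambda>v. snd (fst (snd v))) \<in> borel_measurable PredE"
    by (rule measurable_compose[OF measurable_param_Pred], simp add: borel_prod[symmetric])+
qed

text \<open>Joint measurability in the evaluation point \<open>q\<close> and the integration point
  \<open>v\<close> is what makes the mild map produce fields predictable in (t, x), not just random
  variables for each (t, x).\<close>

lemma integrand_measurable_pair:
  assumes u: "predictable u"
  shows "(\<lambda>(q, v). integrand u (fst q) (fst (snd q)) v) \<in> borel_measurable (Pred (borel :: 'd measure) \<Otimes>\<^sub>M PredE)"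
proof -
  note [measurable] = components_measurable[OF u]
  show ?thesis
    unfolding integrand_def case_prod_beta' by measurable
qed

lemma integrand_measurable:
  assumes u: "predictable u"
  shows "integrand u t x \<in> borel_measurable PredE"
proof -
  note [measurable] = components_measurable[OF u]
  show ?thesis
    unfolding integrand_def case_prod_beta' by measurable
qed

text \<open>At \<open>s = t\<close> the factor \<open>G 0\<close> vanishes, so the interval (0, t]
  of the definition may be replaced by the open one; on the slab \<open>emb\<close> leaves the time
  unchanged.\<close>

lemma indicator_integrand:
  "indicator ({0<..t} \<times> UNIV) z * (case z of (s, y, h) \<Rightarrow> G (t - s) (x - y) * \<sigma> (u s y \<omega>) h)
    = indicator (slab t) z * integrand u t x (emb \<omega> z)"
  by (cases z) (auto simp: integrand_def emb_def G_0 split: split_indicator)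

abbreviation forcing :: "(real \<Rightarrow> 'd \<Rightarrow> 'w \<Rightarrow> real) \<Rightarrow> real \<Rightarrow> 'd \<Rightarrow> real \<Rightarrow> 'd \<Rightarrow> 'd \<Rightarrow> 'w \<Rightarrow> real" where
  "forcing u t x \<equiv> \<lambda>s y h \<omega>. G (t - s) (x - y) * \<sigma> (u s y \<omega>) h"

abbreviation integrable_field :: "(real \<Rightarrow> 'd \<Rightarrow> 'w \<Rightarrow> real) \<Rightarrow> real \<Rightarrow> 'd \<Rightarrow> bool" where
  "integrable_field u t x \<equiv> noise_integrable M \<mu> N t (forcing u t x)"

lemma integrable_field_iff:
  assumes u: "predictable u"
  shows "integrable_field u t x \<longleftrightarrow> (\<integral>\<^sup>+z. (\<integral>\<^sup>+\<omega>. ennreal \<bar>integrand u t x (emb \<omega> z)\<bar> \<partial>M) *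
    indicator (slab t) z \<partial>E) < \<infinity>"
proof -
  have "(\<lambda>(s, (y, h), \<omega>). forcing u t x s y h \<omega>) \<in> borel_measurable PredE"
    using integrand_measurable[OF u, of t x] by (simp add: integrand_def)
  moreover have "(\<integral>\<^sup>+(s, y, h)\<in>{0<..t} \<times> UNIV. (\<integral>\<^sup>+\<omega>. ennreal \<bar>forcing u t x s y h \<omega>\<bar> \<partial>M) \<partial>E)
    = (\<integral>\<^sup>+z. (\<integral>\<^sup>+\<omega>. ennreal \<bar>integrand u t x (emb \<omega> z)\<bar> \<partial>M) * indicator (slab t) z \<partial>E)"
  proof (rule nn_integral_cong)
    fix z :: "real \<times> 'd \<times> 'd"
    obtain s y h where z: "z = (s, y, h)" by (cases z)
    show "(case z of (s, y, h) \<Rightarrow> \<integral>\<^sup>+\<omega>. ennreal \<bar>forcing u t x s y h \<omega>\<bar> \<partial>M) * indicator ({0<..t} \<times> UNIV) z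
      = (\<integral>\<^sup>+\<omega>. ennreal \<bar>integrand u t x (emb \<omega> z)\<bar> \<partial>M) * indicator (slab t) z"
      by (cases "s = t") (auto simp: z integrand_def emb_def G_0 split: split_indicator)
  qed
  ultimately show ?thesis
    by (simp add: noise_integrable_def)
qed

lemma AE_integrand_integrable:
  assumes u: "predictable u" and t: "0 < t" and int: "integrable_field u t x"
  shows "AE \<omega> in M. integrable (N \<omega>) (\<lambda>z. indicator (slab t) z * integrand u t x (emb \<omega> z))"
proof -
  note [measurable] = integrand_measurable[OF u, of t x]
  have "AE \<omega> in M. (\<integral>\<^sup>+z. ennreal \<bar>integrand u t x (emb \<omega> z)\<bar> * indicator (slab t) z \<partial>N \<omega>) < \<infinity>"
    using int[unfolded integrable_field_iff[OF u]]
    by (intro AE_nn_integral_finite[where X="\<lambda>v. ennreal \<bar>integrand u t x v\<bar>"] t) auto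
  then show ?thesis
    using AE_space
  proof eventually_elim
    case (elim \<omega>)
    note [measurable_cong] = sets_N[OF elim(2)]
    note [measurable] = measurable_emb[OF elim(2)]
    have "(\<integral>\<^sup>+z. ennreal (norm (indicator (slab t) z * integrand u t x (emb \<omega> z))) \<partial>N \<omega>)
      = (\<integral>\<^sup>+z. ennreal \<bar>integrand u t x (emb \<omega> z)\<bar> * indicator (slab t) z \<partial>N \<omega>)"
      by (intro nn_integral_cong) (auto split: split_indicator)
    with elim show ?case
      by (intro integrableI_bounded) auto
  qed
qed

lemma noise_integral_eq:
  "noise_integral N t (forcing u t x) \<omega> = (LINT z|N \<omega>. indicator (slab t) z * integrand u t x (emb \<omega> z))"
  unfolding noise_integral_def set_lebesgue_integral_def
  by (intro Bochner_Integration.integral_cong refl) (simp add: indicator_integrand)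

text \<open>Since \<open>ennreal\<close> sends negative numbers to 0, the identity and
  \<open>uminus\<close> in place of \<open>\<phi>\<close> yield the integrals of the positive and of
  the negative part. Infinite mass and infinite integrals are both sent to 0, so the value is a real
  number at every sample point.\<close>

definition part :: "(real \<Rightarrow> real) \<Rightarrow> (real \<Rightarrow> 'd \<Rightarrow> 'w \<Rightarrow> real) \<Rightarrow> real \<Rightarrow> 'd \<Rightarrow> 'w \<Rightarrow> real" where
  "part \<phi> u t x \<omega> = enn2real (if mass t \<omega> < \<infinity>
     then \<integral>\<^sup>+z. ennreal (\<phi> (integrand u t x (emb \<omega> z))) * indicator (slab t) z \<partial>N \<omega> else 0)"

text \<open>A version of the right-hand side of the mild equation that is predictable at every
  sample point; \<open>AE_picard\<close> shows that it is almost surely the pathwise integral when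
  the integrand is integrable.\<close>

definition picard :: "(real \<Rightarrow> 'd \<Rightarrow> 'w \<Rightarrow> real) \<Rightarrow> real \<Rightarrow> 'd \<Rightarrow> 'w \<Rightarrow> real" where
  "picard u t x \<omega> = free t x + (part (\<lambda>r. r) u t x \<omega> - part uminus u t x \<omega>)"

lemma predictable_part:
  assumes u: "predictable u" and [measurable]: "\<phi> \<in> borel_measurable borel"
  shows "predictable (part \<phi> u)"
proof -
  note [measurable] = integrand_measurable_pair[OF u]
  have "(\<lambda>qv. ennreal (\<phi> (integrand u (fst (fst qv)) (fst (snd (fst qv))) (snd qv))))
    \<in> borel_measurable (Pred (borel :: 'd measure) \<Otimes>\<^sub>M PredE)"
    by measurable
  from measurable_compose[OF predictable_nn_integral[OF this] borel_measurable_enn2real[OF measurable_ident]]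
  show ?thesis
    unfolding predictable_field_def part_def case_prod_beta' by (simp only: fst_conv snd_conv prod.collapse id_apply)
qed

lemma predictable_picard:
  assumes u: "predictable u"
  shows "predictable (picard u)"
proof -
  show ?thesis
    unfolding predictable_field_def picard_def case_prod_beta'
    using predictable_part[OF u, of "\<lambda>r. r", unfolded predictable_field_def case_prod_beta']
      predictable_part[OF u, of uminus, unfolded predictable_field_def case_prod_beta']
    by measurable
qed

lemma AE_picard:
  assumes u: "predictable u" and t: "0 < t" and int: "integrable_field u t x"
  shows "AE \<omega> in M. picard u t x \<omega> = free t x + noise_integral N t (forcing u t x) \<omega>"
  using AE_integrand_integrable[OF assms] AE_mass_finite
proof eventually_elim
  case (elim \<omega>)
  have 1: "(\<integral>\<^sup>+z. ennreal (indicator (slab t) z * integrand u t x (emb \<omega> z)) \<partial>N \<omega>)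
    = (\<integral>\<^sup>+z. ennreal (integrand u t x (emb \<omega> z)) * indicator (slab t) z \<partial>N \<omega>)"
    by (intro nn_integral_cong) (auto split: split_indicator)
  have 2: "(\<integral>\<^sup>+z. ennreal (- (indicator (slab t) z * integrand u t x (emb \<omega> z))) \<partial>N \<omega>)
    = (\<integral>\<^sup>+z. ennreal (- integrand u t x (emb \<omega> z)) * indicator (slab t) z \<partial>N \<omega>)"
    by (intro nn_integral_cong) (auto split: split_indicator)
  show ?case
    unfolding noise_integral_eq real_lebesgue_integral_def[OF elim(1)] 1 2
    using elim(2) by (simp add: picard_def part_def)
qed

section \<open>Contraction and integrability estimates\<close>

text \<open>The bound is assumed only at times strictly before \<open>t\<close>, so the estimate can
  be iterated on a finite horizon.\<close>

lemma picard_contraction: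
  assumes u: "predictable u" and v: "predictable v" and t: "0 < t" and c: "0 \<le> c"
    and int_u: "integrable_field u t x" and int_v: "integrable_field v t x"
    and bound: "\<And>s y. 0 < s \<Longrightarrow> s < t \<Longrightarrow> L1 (\<lambda>\<omega>. u s y \<omega> - v s y \<omega>) \<le> ennreal (c * exp (rate * s))"
  shows "L1 (\<lambda>\<omega>. picard u t x \<omega> - picard v t x \<omega>) \<le> ennreal (c / 2 * exp (rate * t))"
proof -
  note [measurable] = integrand_measurable[OF u, of t x] integrand_measurable[OF v, of t x]
  let ?D = "\<lambda>v'. ennreal \<bar>integrand u t x v' - integrand v t x v'\<bar>"
  have "L1 (\<lambda>\<omega>. picard u t x \<omega> - picard v t x \<omega>) \<le> (\<integral>\<^sup>+\<omega>. (\<integral>\<^sup>+z. ?D (emb \<omega> z) * indicator (slab t) z \<partial>N \<omega>) \<partial>M)"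
  proof (rule nn_integral_mono_AE)
    show "AE \<omega> in M. ennreal \<bar>picard u t x \<omega> - picard v t x \<omega>\<bar> \<le> (\<integral>\<^sup>+z. ?D (emb \<omega> z) * indicator (slab t) z \<partial>N \<omega>)"
      using AE_picard[OF u t int_u] AE_picard[OF v t int_v] AE_integrand_integrable[OF u t int_u]
        AE_integrand_integrable[OF v t int_v]
    proof eventually_elim
      case (elim \<omega>)
      let ?f = "\<lambda>u z. indicator (slab t) z * integrand u t x (emb \<omega> z)"
      have "picard u t x \<omega> - picard v t x \<omega> = (LINT z|N \<omega>. ?f u z - ?f v z)"
        using elim by (simp add: noise_integral_eq)
      then have "ennreal \<bar>picard u t x \<omega> - picard v t x \<omega>\<bar> \<le> (\<integral>\<^sup>+z. ennreal (norm (?f u z - ?f v z)) \<partial>N \<omega>)"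
        using integral_norm_bound_ennreal[OF Bochner_Integration.integrable_diff[OF elim(3,4)]] by simp
      also have "\<dots> = (\<integral>\<^sup>+z. ?D (emb \<omega> z) * indicator (slab t) z \<partial>N \<omega>)"
        by (intro nn_integral_cong) (auto split: split_indicator)
      finally show ?case .
    qed
  qed
  \<comment> \<open>The mean formula turns the random integral into a deterministic one; what
    remains is the Lipschitz bound pointwise.\<close>
  also have "\<dots> = (\<integral>\<^sup>+z. (\<integral>\<^sup>+\<omega>. ?D (emb \<omega> z) \<partial>M) * indicator (slab t) z \<partial>E)"
    by (rule predictable_mean[OF _ t]) measurable
  also have "\<dots> \<le> (\<integral>\<^sup>+z. ennreal (G (t - fst z) (x - fst (snd z)) * J (snd (snd z)) * Lip * (c * exp (rate *
    fst z))) * indicator (slab t) z \<partial>E)"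
  proof (rule nn_integral_mono)
    fix z :: "real \<times> 'd \<times> 'd"
    obtain s y h where z: "z = (s, y, h)" by (cases z)
    show "(\<integral>\<^sup>+\<omega>. ?D (emb \<omega> z) \<partial>M) * indicator (slab t) z
      \<le> ennreal (G (t - fst z) (x - fst (snd z)) * J (snd (snd z)) * Lip * (c * exp (rate * fst z))) *
        indicator (slab t) z"
    proof (cases "z \<in> slab t")
      case True
      then have s: "0 < s" "s < t" by (auto simp: z)
      have g: "0 \<le> G (t - s) (x - y) * J h * Lip"
        using G_nonneg J_nonneg Lip by simp
      note [measurable] = predictable_section[OF u s(1), of y] predictable_section[OF v s(1), of y]
      have "(\<integral>\<^sup>+\<omega>. ?D (emb \<omega> z) \<partial>M) \<le> (\<integral>\<^sup>+\<omega>. ennreal (G (t - s) (x - y) * J h * Lip) *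
        ennreal \<bar>u s y \<omega> - v s y \<omega>\<bar> \<partial>M)"
      proof (rule nn_integral_mono)
        fix \<omega>
        have "integrand u t x (emb \<omega> z) - integrand v t x (emb \<omega> z) = G (t - s) (x - y) *
          (\<sigma> (u s y \<omega>) h - \<sigma> (v s y \<omega>) h)"
          using s by (simp add: integrand_def emb_def z algebra_simps)
        then have "\<bar>integrand u t x (emb \<omega> z) - integrand v t x (emb \<omega> z)\<bar> \<le> G (t - s) (x - y) * (J h * Lip *
          \<bar>u s y \<omega> - v s y \<omega>\<bar>)"
          using G_nonneg \<sigma>_Lipschitz by (simp add: abs_mult mult_left_mono)
        then show "?D (emb \<omega> z) \<le> ennreal (G (t - s) (x - y) * J h * Lip) * ennreal \<bar>u s y \<omega> - v s y \<omega>\<bar>"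
          using g by (subst ennreal_mult[symmetric]) (auto intro!: ennreal_leI simp: ac_simps)
      qed
      also have "\<dots> = ennreal (G (t - s) (x - y) * J h * Lip) * L1 (\<lambda>\<omega>. u s y \<omega> - v s y \<omega>)"
        by (rule nn_integral_cmult) measurable
      also have "\<dots> \<le> ennreal (G (t - s) (x - y) * J h * Lip) * ennreal (c * exp (rate * s))"
        by (intro mult_left_mono bound s) simp
      also have "\<dots> = ennreal (G (t - s) (x - y) * J h * Lip * (c * exp (rate * s)))"
        using g c by (simp add: ennreal_mult)
      finally show ?thesis using True by (simp add: z)
    qed simp
  qed
  also have "\<dots> \<le> ennreal (c / 2 * exp (rate * t))"
    using t by (intro weighted_contraction c) simp
  finally show ?thesis .
qed

text \<open>Comparison with the zero field: \<open>\<sigma> 0 h = 0\<close> turns the Lipschitz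
  condition into \<open>\<bar>\<sigma> r h\<bar> \<le> J h * Lip * \<bar>r\<bar>\<close>, and the
  weighted estimate applies as for differences.\<close>

lemma integrable_field_of_bound:
  assumes u: "predictable u" and t: "0 < t" and c: "0 \<le> c"
    and bound: "\<And>s y. 0 < s \<Longrightarrow> s < t \<Longrightarrow> L1 (u s y) \<le> ennreal (c * exp (rate * s))"
  shows "integrable_field u t x"
proof -
  note [measurable] = integrand_measurable[OF u, of t x]
  have "(\<integral>\<^sup>+z. (\<integral>\<^sup>+\<omega>. ennreal \<bar>integrand u t x (emb \<omega> z)\<bar> \<partial>M) * indicator (slab t) z \<partial>E)
    \<le> (\<integral>\<^sup>+z. ennreal (G (t - fst z) (x - fst (snd z)) * J (snd (snd z)) * Lip * (c * exp (rate * fst z))) *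
      indicator (slab t) z \<partial>E)"
  proof (rule nn_integral_mono)
    fix z :: "real \<times> 'd \<times> 'd"
    obtain s y h where z: "z = (s, y, h)" by (cases z)
    show "(\<integral>\<^sup>+\<omega>. ennreal \<bar>integrand u t x (emb \<omega> z)\<bar> \<partial>M) * indicator (slab t) z
      \<le> ennreal (G (t - fst z) (x - fst (snd z)) * J (snd (snd z)) * Lip * (c * exp (rate * fst z))) *
        indicator (slab t) z"
    proof (cases "z \<in> slab t")
      case True
      then have s: "0 < s" "s < t" by (auto simp: z)
      have g: "0 \<le> G (t - s) (x - y) * J h * Lip"
        using G_nonneg J_nonneg Lip by simp
      note [measurable] = predictable_section[OF u s(1), of y]
      have "(\<integral>\<^sup>+\<omega>. ennreal \<bar>integrand u t x (emb \<omega> z)\<bar> \<partial>M) \<le> (\<integral>\<^sup>+\<omega>. ennreal (G (t - s) (x - y) * J h * Lip) *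
        ennreal \<bar>u s y \<omega>\<bar> \<partial>M)"
      proof (rule nn_integral_mono)
        fix \<omega>
        have "\<bar>\<sigma> (u s y \<omega>) h\<bar> \<le> J h * Lip * \<bar>u s y \<omega>\<bar>"
          using \<sigma>_Lipschitz[of "u s y \<omega>" h 0] by (simp add: \<sigma>_0)
        then have "\<bar>integrand u t x (emb \<omega> z)\<bar> \<le> G (t - s) (x - y) * (J h * Lip * \<bar>u s y \<omega>\<bar>)"
          using G_nonneg s by (simp add: integrand_def emb_def z abs_mult mult_left_mono)
        then show "ennreal \<bar>integrand u t x (emb \<omega> z)\<bar> \<le> ennreal (G (t - s) (x - y) * J h * Lip) * ennreal \<bar>u s y \<omega>\<bar>"
          using g by (subst ennreal_mult[symmetric]) (auto intro!: ennreal_leI simp: ac_simps)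
      qed
      also have "\<dots> = ennreal (G (t - s) (x - y) * J h * Lip) * L1 (u s y)"
        by (rule nn_integral_cmult) measurable
      also have "\<dots> \<le> ennreal (G (t - s) (x - y) * J h * Lip) * ennreal (c * exp (rate * s))"
        by (intro mult_left_mono bound s) simp
      also have "\<dots> = ennreal (G (t - s) (x - y) * J h * Lip * (c * exp (rate * s)))"
        using g c by (simp add: ennreal_mult)
      finally show ?thesis using True by (simp add: z)
    qed simp
  qed
  also have "\<dots> \<le> ennreal (c / 2 * exp (rate * t))"
    using t by (intro weighted_contraction c) simp
  also have "\<dots> < \<infinity>" by simp
  finally show ?thesis
    unfolding integrable_field_iff[OF u] .
qed

end

section \<open>Existence and uniqueness\<close>

lemma ennreal_le_halving_imp_0:
  fixes a :: ennreal
  assumes "\<And>n::nat. a \<le> ennreal (C / 2 ^ n * D)"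
  shows "a = 0"
proof -
  have "(\<lambda>n. C / 2 ^ n * D) \<longlonglongrightarrow> 0"
    by real_asymp
  then have "(\<lambda>n. ennreal (C / 2 ^ n * D)) \<longlonglongrightarrow> ennreal 0"
    by (rule tendsto_ennrealI)
  then have "a \<le> ennreal 0"
    by (rule LIMSEQ_le_const) (use assms in blast)
  then show ?thesis by simp
qed

context mild_equation
begin

abbreviation zero_field :: "real \<Rightarrow> 'd \<Rightarrow> 'w \<Rightarrow> real" where
  "zero_field \<equiv> \<lambda>_ _ _. 0"

lemma predictable_zero_field: "predictable zero_field"
  unfolding predictable_field_def by simp

lemma L1_const: "L1 (\<lambda>_. r) = ennreal \<bar>r\<bar>"
  by (simp add: emeasure_space_1)

lemma exp_rate_ge_1: "0 \<le> t \<Longrightarrow> 1 \<le> exp (rate * t)"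
  using rate_pos by simp

text \<open>As \<open>\<sigma> 0 h = 0\<close>, the noise term vanishes and the first iterate is
  almost surely the deterministic term.\<close>

lemma L1_picard_zero_field:
  assumes t: "0 < t"
  shows "L1 (picard zero_field t x) \<le> ennreal A"
proof -
  have "integrable_field zero_field t x"
    by (rule integrable_field_of_bound[OF predictable_zero_field t, of 0]) auto
  then have "AE \<omega> in M. picard zero_field t x \<omega> = free t x + noise_integral N t (forcing zero_field t x) \<omega>"
    by (rule AE_picard[OF predictable_zero_field t])
  then have "AE \<omega> in M. ennreal \<bar>picard zero_field t x \<omega>\<bar> = ennreal \<bar>free t x\<bar>"
    by eventually_elim (simp add: \<sigma>_0 noise_integral_def set_lebesgue_integral_def case_prod_beta')
  then have "L1 (picard zero_field t x) = L1 (\<lambda>_. free t x)"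
    by (rule nn_integral_cong_AE)
  then show ?thesis
    using free_bound[of t x] A_nonneg by (simp only: L1_const ennreal_leI)
qed

section \<open>Convergence of the Picard iterates\<close>

abbreviation iterate :: "nat \<Rightarrow> real \<Rightarrow> 'd \<Rightarrow> 'w \<Rightarrow> real" where
  "iterate n \<equiv> (picard ^^ n) zero_field"

lemma predictable_iterate: "predictable (iterate n)"
  by (induction n) (auto intro: predictable_zero_field predictable_picard)

text \<open>The constant 2 A reproduces itself: the contraction halves it to A, the image of the
  zero field adds at most A, and the exponential weight is at least 1.\<close>

lemma iterate_bound: "0 < t \<Longrightarrow> L1 (iterate n t x) \<le> ennreal (2 * A * exp (rate * t))"
proof (induction n arbitrary: t x)
  case (Suc n)
  let ?u = "iterate n"
  note meas = predictable_section[OF predictable_picard[OF predictable_iterate] \<open>0 < t\<close>, of n x]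
    predictable_section[OF predictable_picard[OF predictable_zero_field] \<open>0 < t\<close>, of x]
  have "L1 (\<lambda>\<omega>. (picard ?u t x \<omega> - picard zero_field t x \<omega>) + picard zero_field t x \<omega>)
    \<le> L1 (\<lambda>\<omega>. picard ?u t x \<omega> - picard zero_field t x \<omega>) + L1 (picard zero_field t x)"
    using meas by (intro L1_triangle) auto
  also have "\<dots> \<le> ennreal (2 * A / 2 * exp (rate * t)) + ennreal A"
  proof (intro add_mono L1_picard_zero_field Suc.prems picard_contraction predictable_iterate predictable_zero_field)
    show "integrable_field ?u t x"
      using A_nonneg by (intro integrable_field_of_bound[where c="2 * A"] predictable_iterate Suc) auto
    show "integrable_field zero_field t x"
      by (rule integrable_field_of_bound[OF predictable_zero_field \<open>0 < t\<close>, of 0]) auto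
  qed (use A_nonneg Suc.IH in auto)
  also have "\<dots> \<le> ennreal (2 * A * exp (rate * t))"
    using A_nonneg exp_rate_ge_1[of t] Suc.prems mult_left_mono[of 1 "exp (rate * t)" A]
    by (simp flip: ennreal_plus add: ennreal_leI)
  finally show ?case by simp
qed simp

lemma integrable_field_iterate: "0 < t \<Longrightarrow> integrable_field (iterate n) t x"
  using A_nonneg by (intro integrable_field_of_bound[where c="2 * A"] predictable_iterate iterate_bound) auto

lemma iterate_diff:
  "0 < t \<Longrightarrow> L1 (\<lambda>\<omega>. iterate (Suc n) t x \<omega> - iterate n t x \<omega>) \<le> ennreal (2 * A / 2 ^ n * exp (rate * t))"
proof (induction n arbitrary: t x)
  case 0
  then show ?case using iterate_bound[of t 1 x] by simp
next
  case (Suc n)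
  have "L1 (\<lambda>\<omega>. picard (iterate (Suc n)) t x \<omega> - picard (iterate n) t x \<omega>) \<le> ennreal ((2 * A / 2 ^ n) / 2 *
    exp (rate * t))"
    using A_nonneg
    by (intro picard_contraction predictable_iterate integrable_field_iterate Suc) auto
  then show ?case by (simp add: field_simps)
qed

text \<open>Taken at every sample point; where the iterates diverge, \<open>lim\<close> is a fixed
  unspecified number. The field is therefore predictable without discarding a null set.\<close>

definition solution :: "real \<Rightarrow> 'd \<Rightarrow> 'w \<Rightarrow> real" where
  "solution t x \<omega> = lim (\<lambda>n. iterate n t x \<omega>)"

lemma predictable_solution: "predictable solution"
  using predictable_iterate unfolding predictable_field_def solution_def case_prod_beta'
  by (intro borel_measurable_lim_metric) auto

text \<open>The increments have summable means, so the telescoping series converges absolutely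
  almost surely. The constant is the geometric tail: the sum over k of 2 A / 2^(k + m) is 4 A /
  2^m.\<close>

lemma solution_diff:
  assumes t: "0 < t"
  shows "L1 (\<lambda>\<omega>. solution t x \<omega> - iterate m t x \<omega>) \<le> ennreal (4 * A / 2 ^ m * exp (rate * t))"
proof -
  note [measurable] = predictable_section[OF predictable_iterate t]
  define d where "d k \<omega> = iterate (Suc k) t x \<omega> - iterate k t x \<omega>" for k \<omega>
  have [measurable]: "d k \<in> borel_measurable M" for k
    unfolding d_def by measurable
  have tail: "(\<Sum>k. L1 (d (k + m))) \<le> ennreal (4 * A / 2 ^ m * exp (rate * t))" for m
  proof -
    have s: "(\<lambda>k. (2 * A / 2 ^ m * exp (rate * t)) * (1 / 2) ^ k) sums ((2 * A / 2 ^ m * exp (rate * t)) *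
      (1 / (1 - 1 / 2)))"
      by (intro sums_mult geometric_sums) simp
    have "(\<Sum>k. L1 (d (k + m))) \<le> (\<Sum>k. ennreal ((2 * A / 2 ^ m * exp (rate * t)) * (1 / 2) ^ k))"
    proof (intro suminf_le)
      show "L1 (d (k + m)) \<le> ennreal ((2 * A / 2 ^ m * exp (rate * t)) * (1 / 2) ^ k)" for k
        using iterate_diff[OF t, of "k + m" x] by (simp add: d_def power_add power_one_over field_simps)
    qed auto
    also have "\<dots> = ennreal ((2 * A / 2 ^ m * exp (rate * t)) * (1 / (1 - 1 / 2)))"
      using A_nonneg by (intro suminf_ennreal_eq s) auto
    finally show ?thesis by (simp add: field_simps)
  qed
  have total: "(\<integral>\<^sup>+\<omega>. (\<Sum>k. ennreal \<bar>d (k + m) \<omega>\<bar>) \<partial>M) = (\<Sum>k. L1 (d (k + m)))" for m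
    by (rule nn_integral_suminf) measurable
  have "AE \<omega> in M. (\<Sum>k. ennreal \<bar>d (k + 0) \<omega>\<bar>) \<noteq> \<infinity>"
    using tail[of 0] by (intro nn_integral_PInf_AE) (auto simp: total[of 0, simplified] top_unique)
  then have "AE \<omega> in M. ennreal \<bar>solution t x \<omega> - iterate m t x \<omega>\<bar> \<le> (\<Sum>k. ennreal \<bar>d (k + m) \<omega>\<bar>)"
  proof eventually_elim
    case (elim \<omega>)
    then have sum: "summable (\<lambda>k. \<bar>d k \<omega>\<bar>)"
      by (intro summable_suminf_not_top) auto
    \<comment> \<open>The sum telescopes to \<open>iterate n\<close> because
      \<open>iterate 0\<close> is the zero field.\<close>
    have "(\<Sum>k<n. d k \<omega>) = iterate n t x \<omega>" for n
      unfolding d_def by (subst sum_lessThan_telescope) simp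
    then have "(\<lambda>n. iterate n t x \<omega>) \<longlonglongrightarrow> suminf (\<lambda>k. d k \<omega>)"
      using summable_LIMSEQ[OF summable_rabs_cancel[OF sum]] by simp
    then have lim: "(\<lambda>n. iterate n t x \<omega>) \<longlonglongrightarrow> solution t x \<omega>"
      unfolding solution_def by (simp add: limI)
    have "(\<lambda>k. d (k + m) \<omega>) sums (solution t x \<omega> - iterate m t x \<omega>)"
      using telescope_sums[OF LIMSEQ_ignore_initial_segment[OF lim, of m]] by (simp add: d_def)
    then have "solution t x \<omega> - iterate m t x \<omega> = (\<Sum>k. d (k + m) \<omega>)"
      by (simp add: sums_iff)
    also have "\<bar>\<dots>\<bar> \<le> (\<Sum>k. \<bar>d (k + m) \<omega>\<bar>)"
      using sum by (intro summable_rabs summable_ignore_initial_segment)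
    finally have "ennreal \<bar>solution t x \<omega> - iterate m t x \<omega>\<bar> \<le> ennreal (\<Sum>k. \<bar>d (k + m) \<omega>\<bar>)"
      by (rule ennreal_leI)
    also have "\<dots> = (\<Sum>k. ennreal \<bar>d (k + m) \<omega>\<bar>)"
      using sum by (intro suminf_ennreal2[symmetric] summable_ignore_initial_segment) auto
    finally show ?case .
  qed
  then have "L1 (\<lambda>\<omega>. solution t x \<omega> - iterate m t x \<omega>) \<le> (\<integral>\<^sup>+\<omega>. (\<Sum>k. ennreal \<bar>d (k + m) \<omega>\<bar>) \<partial>M)"
    by (rule nn_integral_mono_AE)
  with tail[of m] show ?thesis by (simp add: total)
qed

lemma solution_bound: "0 < t \<Longrightarrow> L1 (solution t x) \<le> ennreal (4 * A * exp (rate * t))"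
  using solution_diff[of t x 0] by simp

lemma integrable_field_solution: "0 < t \<Longrightarrow> integrable_field solution t x"
  using A_nonneg by (intro integrable_field_of_bound[where c="4 * A"] predictable_solution solution_bound) auto

text \<open>Both sides are close to iterate m + 1: the solution by the tail estimate, its image
  because the contraction halves the distance between the solution and iterate m. The two errors
  agree and add up to one that vanishes as m grows.\<close>

lemma solution_fixed_point:
  assumes t: "0 < t"
  shows "AE \<omega> in M. solution t x \<omega> = picard solution t x \<omega>"
proof -
  note [measurable] = predictable_section[OF predictable_iterate t] predictable_section[OF predictable_solution t]
    predictable_section[OF predictable_picard[OF predictable_solution] t]
  have "L1 (\<lambda>\<omega>. solution t x \<omega> - picard solution t x \<omega>) \<le> ennreal (4 * A / 2 ^ m * exp (rate * t))" for m
  proof -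
    have 1: "L1 (\<lambda>\<omega>. solution t x \<omega> - iterate (Suc m) t x \<omega>) \<le> ennreal (4 * A / 2 ^ Suc m * exp (rate * t))"
      by (rule solution_diff[OF t])
    have "L1 (\<lambda>\<omega>. picard solution t x \<omega> - picard (iterate m) t x \<omega>) \<le> ennreal ((4 * A / 2 ^ m) / 2 * exp (rate * t))"
      using A_nonneg
      by (intro picard_contraction predictable_solution predictable_iterate integrable_field_solution
          integrable_field_iterate solution_diff t) auto
    then have 2: "L1 (\<lambda>\<omega>. iterate (Suc m) t x \<omega> - picard solution t x \<omega>) \<le> ennreal (4 * A / 2 ^ Suc m * exp (rate *
      t))"
      by (simp add: abs_minus_commute field_simps)
    have "L1 (\<lambda>\<omega>. (solution t x \<omega> - iterate (Suc m) t x \<omega>) + (iterate (Suc m) t x \<omega> - picard solution t x \<omega>))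
      \<le> L1 (\<lambda>\<omega>. solution t x \<omega> - iterate (Suc m) t x \<omega>) + L1 (\<lambda>\<omega>. iterate (Suc m) t x \<omega> - picard solution t x \<omega>)"
      by (rule L1_triangle) measurable
    also have "\<dots> \<le> ennreal (4 * A / 2 ^ Suc m * exp (rate * t)) + ennreal (4 * A / 2 ^ Suc m * exp (rate * t))"
      by (rule add_mono[OF 1 2])
    also have "\<dots> = ennreal (4 * A / 2 ^ m * exp (rate * t))"
      using A_nonneg by (simp flip: ennreal_plus add: field_simps)
    finally show ?thesis by simp
  qed
  then have "L1 (\<lambda>\<omega>. solution t x \<omega> - picard solution t x \<omega>) = 0"
    by (rule ennreal_le_halving_imp_0)
  then have "AE \<omega> in M. ennreal \<bar>solution t x \<omega> - picard solution t x \<omega>\<bar> = 0"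
    by (subst (asm) nn_integral_0_iff_AE) auto
  then show ?thesis by eventually_elim simp
qed

lemma random_field_solution_solution: "random_field_solution M \<mu> N G \<sigma> u0 solution"
  unfolding random_field_solution_def mild_solution_def
proof (intro conjI allI impI)
  show "predictable solution" by (rule predictable_solution)
  fix t :: real and x assume t: "0 < t"
  show "integrable lborel (\<lambda>y. G t (x - y) * u0 y)" by (rule free_integrable)
  show "integrable_field solution t x" by (rule integrable_field_solution[OF t])
  show "AE \<omega> in M. solution t x \<omega> = (LINT y|lborel. G t (x - y) * u0 y) + noise_integral N t (forcing solution t x) \<omega>"
    using solution_fixed_point[OF t, of x] AE_picard[OF predictable_solution t integrable_field_solution[OF t], of x]
    by eventually_elim (simp add: free_def)
next
  fix T :: real assume T: "0 < T"
  have "L1 (\<lambda>\<omega>. if t = 0 then u0 x else solution t x \<omega>) \<le> ennreal (4 * A * exp (rate * T))" if "t \<in> {0..T}" for t x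
  proof (cases "t = 0")
    case True
    have "L1 (\<lambda>_. u0 x) \<le> ennreal (4 * A * exp (rate * T))"
      unfolding L1_const using u0_bound[of x] A_nonneg T exp_rate_ge_1[of T] mult_left_mono[of 1 "exp (rate * T)" A]
      by (intro ennreal_leI) auto
    with True show ?thesis by simp
  next
    case False
    with that have t: "0 < t" "t \<le> T" by auto
    have "L1 (solution t x) \<le> ennreal (4 * A * exp (rate * t))"
      by (rule solution_bound[OF t(1)])
    also have "\<dots> \<le> ennreal (4 * A * exp (rate * T))"
      using t A_nonneg rate_pos by (intro ennreal_leI mult_left_mono) auto
    finally show ?thesis using False by simp
  qed
  then have "(SUP t\<in>{0..T}. SUP x. L1 (\<lambda>\<omega>. if t = 0 then u0 x else solution t x \<omega>)) \<le> ennreal (4 * A * exp (rate *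
    T))"
    by (intro SUP_least)
  also have "\<dots> < \<infinity>" by simp
  finally show "(SUP t\<in>{0..T}. SUP x. L1 (\<lambda>\<omega>. if t = 0 then u0 x else solution t x \<omega>)) < \<infinity>" .
qed

section \<open>Uniqueness up to modification\<close>

lemma random_field_solution_bound:
  assumes u: "random_field_solution M \<mu> N G \<sigma> u0 u" and T: "0 < T"
  obtains B where "0 \<le> B" "\<And>t x. 0 < t \<Longrightarrow> t \<le> T \<Longrightarrow> L1 (u t x) \<le> ennreal B"
proof -
  let ?S = "SUP t\<in>{0..T}. SUP x. L1 (\<lambda>\<omega>. if t = 0 then u0 x else u t x \<omega>)"
  have "?S < \<infinity>"
    using u T by (simp add: random_field_solution_def)
  then obtain B where B: "0 \<le> B" "?S = ennreal B"
    by (cases ?S rule: ennreal_cases) auto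
  show thesis
  proof
    fix t x assume t: "0 < t" "t \<le> T"
    have "L1 (u t x) = L1 (\<lambda>\<omega>. if t = 0 then u0 x else u t x \<omega>)"
      using t by simp
    also have "\<dots> \<le> ?S"
      using t by (intro SUP_upper2[of t] SUP_upper) auto
    finally show "L1 (u t x) \<le> ennreal B" using B by simp
  qed fact
qed

text \<open>On (0, T] the two solutions have bounded first moments, say by \<open>B\<close> and
  \<open>C\<close>. As the exponential weight is at least 1, their difference starts with weighted
  constant \<open>B + C\<close>. Each solution equals its own image under \<open>picard\<close>
  almost surely, so every contraction step halves this constant.\<close>

lemma random_field_solution_unique:
  assumes u: "random_field_solution M \<mu> N G \<sigma> u0 u" and v: "random_field_solution M \<mu> N G \<sigma> u0 v"
  shows "modification M u v"
  unfolding modification_def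
proof (intro allI impI)
  fix T :: real and x assume T: "0 < T"
  have pred: "predictable u" "predictable v"
    and int: "\<And>t x. 0 < t \<Longrightarrow> integrable_field u t x" "\<And>t x. 0 < t \<Longrightarrow> integrable_field v t x"
    and mild: "\<And>t x. 0 < t \<Longrightarrow> AE \<omega> in M. u t x \<omega> = free t x + noise_integral N t (forcing u t x) \<omega>"
      "\<And>t x. 0 < t \<Longrightarrow> AE \<omega> in M. v t x \<omega> = free t x + noise_integral N t (forcing v t x) \<omega>"
    using u v unfolding random_field_solution_def mild_solution_def free_def by blast+
  obtain B where B: "0 \<le> B" "\<And>t x. 0 < t \<Longrightarrow> t \<le> T \<Longrightarrow> L1 (u t x) \<le> ennreal B"
    using random_field_solution_bound[OF u T] by metis
  obtain C where C: "0 \<le> C" "\<And>t x. 0 < t \<Longrightarrow> t \<le> T \<Longrightarrow> L1 (v t x) \<le> ennreal C"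
    using random_field_solution_bound[OF v T] by metis
  have step: "L1 (\<lambda>\<omega>. u t x \<omega> - v t x \<omega>) \<le> ennreal ((B + C) / 2 ^ n * exp (rate * t))" if "0 < t" "t \<le> T" for t x n
    using that
  proof (induction n arbitrary: t x)
    case 0
    note [measurable] = predictable_section[OF pred(1) 0(1), of x] predictable_section[OF pred(2) 0(1), of x]
    have "L1 (\<lambda>\<omega>. u t x \<omega> + - v t x \<omega>) \<le> L1 (u t x) + L1 (\<lambda>\<omega>. - v t x \<omega>)"
      by (rule L1_triangle) measurable
    also have "\<dots> \<le> ennreal B + ennreal C"
      using B(2)[OF 0] C(2)[OF 0] by (intro add_mono) auto
    also have "\<dots> \<le> ennreal ((B + C) * exp (rate * t))"
      using B(1) C(1) exp_rate_ge_1[of t] 0 mult_left_mono[of 1 "exp (rate * t)" "B + C"]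
      by (simp flip: ennreal_plus add: ennreal_leI)
    finally show ?case by simp
  next
    case (Suc n)
    have "AE \<omega> in M. ennreal \<bar>u t x \<omega> - v t x \<omega>\<bar> = ennreal \<bar>picard u t x \<omega> - picard v t x \<omega>\<bar>"
      using mild(1)[OF Suc.prems(1), of x] mild(2)[OF Suc.prems(1), of x]
        AE_picard[OF pred(1) Suc.prems(1) int(1)[OF Suc.prems(1)], of x]
          AE_picard[OF pred(2) Suc.prems(1) int(2)[OF Suc.prems(1)], of x]
      by eventually_elim simp
    then have "L1 (\<lambda>\<omega>. u t x \<omega> - v t x \<omega>) = L1 (\<lambda>\<omega>. picard u t x \<omega> - picard v t x \<omega>)"
      by (rule nn_integral_cong_AE)
    also have "\<dots> \<le> ennreal ((B + C) / 2 ^ n / 2 * exp (rate * t))"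
      using B(1) C(1) Suc.prems
      by (intro picard_contraction pred int Suc) auto
    finally show ?case by (simp add: field_simps)
  qed
  note [measurable] = predictable_section[OF pred(1) T, of x] predictable_section[OF pred(2) T, of x]
  have "L1 (\<lambda>\<omega>. u T x \<omega> - v T x \<omega>) = 0"
    using step[OF T order_refl] by (rule ennreal_le_halving_imp_0)
  then have "AE \<omega> in M. ennreal \<bar>u T x \<omega> - v T x \<omega>\<bar> = 0"
    by (subst (asm) nn_integral_0_iff_AE) auto
  then show "AE \<omega> in M. u T x \<omega> = v T x \<omega>"
    by eventually_elim simp
qed

end

theorem theorem2p6:
  fixes M :: "'w measure"
    and \<mu> :: "'d::euclidean_space measure"
    and N :: "'w \<Rightarrow> (real \<times> 'd \<times> 'd) measure"
    and \<alpha> \<beta> \<nu> Lip K :: real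
    and p :: "real \<Rightarrow> 'd \<Rightarrow> real"
    and g :: "real \<Rightarrow> real"
    and u\<^sub>0 J :: "'d \<Rightarrow> real"
    and \<sigma> :: "real \<Rightarrow> 'd \<Rightarrow> real"
  assumes "prob_space M"
    and "levy_measure \<mu>"
    and "poisson_random_measure M (noise_intensity \<mu>) N"
    and "0 < \<alpha>" and "\<alpha> \<le> 2" and "0 < \<beta>" and "\<beta> < 1" and "0 < \<nu>"
    and "isotropic_stable_density \<alpha> \<nu> p"
    and "stable_subordinator_density \<beta> g"
    and "u\<^sub>0 \<in> borel_measurable borel" and "bounded (range u\<^sub>0)"
    and "(\<lambda>(x, h). \<sigma> x h) \<in> borel_measurable borel"
    and "J \<in> borel_measurable borel" and "\<And>h. 0 \<le> J h"
    and "0 < Lip" and "0 < K"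
    and "\<And>h. \<sigma> 0 h = 0"
    and "\<And>x y h. \<bar>\<sigma> x h - \<sigma> y h\<bar> \<le> J h * Lip * \<bar>x - y\<bar>"
    and "(\<integral>\<^sup>+h. ennreal (J h) \<partial>\<mu>) \<le> ennreal K"
  shows "(\<exists>u. random_field_solution M \<mu> N (fundamental_solution \<beta> p g) \<sigma> u\<^sub>0 u) \<and>
         (\<forall>u v. random_field_solution M \<mu> N (fundamental_solution \<beta> p g) \<sigma> u\<^sub>0 u \<longrightarrow>
                random_field_solution M \<mu> N (fundamental_solution \<beta> p g) \<sigma> u\<^sub>0 v \<longrightarrow>
                modification M u v)"
proof -
  obtain A where A: "\<And>x. \<bar>u\<^sub>0 x\<bar> \<le> A"
    using assms(12) by (auto simp: bounded_iff)
  interpret mild_equation M \<mu> N "fundamental_solution \<beta> p g" \<sigma> u\<^sub>0 J Lip K A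
    by (intro mild_equation.intro poisson_noise.intro poisson_noise_axioms.intro mild_equation_axioms.intro
        fundamental_solution_measurable[OF assms(9,10,6)] fundamental_solution_nonneg[OF assms(9,10,6)]
        fundamental_solution_0 fundamental_solution_nn_integral[OF assms(9,10,6)] A assms)
  show ?thesis
    using random_field_solution_solution random_field_solution_unique by blast
qed

end
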